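(* Let $\theta\in C^{\omega}(\mathbb{R}/\mathbb{Z},\mathbb{R})$ be nonconstant (real analytic), let $k\in\mathbb{Z}$, and let $v(x)=e^{2\pi i[kx+\theta(x)]}$. Let $q(\theta)$ be the largest positive integer $q$ such that $\theta(x+\frac1q)=\theta(x)$ for all $x$. Then there exists a finite set $\mathcal{F}=\mathcal{F}(\theta,k)\subset\mathbb{R}/\mathbb{Z}\times\partial\mathbb{D}$ with $$\pi_1(\mathcal{F})\subset\left\{\tfrac{p}{q(\theta)}: p=0,1,\ldots,q(\theta)-1\right\}$$ having the following property. For any compact set $\mathcal{C}\subset(\mathbb{R}/\mathbb{Z}\times\partial\mathbb{D})\setminus\mathcal{F}$ there exists a constant $c_0=c_0(\theta,k,\mathcal{C})\in\mathbb{R}$ such that $$L(\alpha,A^{(E,\lambda v)})\ge-\frac12\ln(1-\lambda)+c_0$$ for all $(\alpha,E;\lambda)\in\mathcal{C}\times(0,1)$. Moreover, $$L(\alpha,A^{(E,\lambda v)})=0$$ for all $(\alpha,E;\lambda)\in\mathcal{F}\times(0,1)$.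
   Context: $\mathbb{D}$ is the open unit disk in $\mathbb{C}$, and $\pi_1:\mathbb{R}/\mathbb{Z}\times\partial\mathbb{D}\to\mathbb{R}/\mathbb{Z}$ is the projection to the first component. For $E\in\partial\mathbb{D}$, $\lambda\in(0,1)$ and $v:\mathbb{R}/\mathbb{Z}\to\partial\mathbb{D}$, the quasiperiodic Szegő cocycle map is $$A^{(E,\lambda v)}(x)=(1-\lambda^2)^{-1/2}\begin{pmatrix}\sqrt E& \frac{-\lambda\overline{v(x)}}{\sqrt E}\\ -\lambda v(x)\sqrt E&\frac{1}{\sqrt E}\end{pmatrix}$$ (the choice of square root changes it only by a sign). For $\alpha\in\mathbb{R}/\mathbb{Z}$ (rational or irrational) and continuous $A:\mathbb{R}/\mathbb{Z}\to SL(2,\mathbb{C})$, put $A_n(x)=A(x+(n-1)\alpha)\cdots A(x)$ for $n\ge 1$. The Lyapunov exponent is $L(\alpha,A)=\lim_{n\to\infty}\frac1n\int_{\mathbb{R}/\mathbb{Z}}\ln\|A_n(x)\|\,dx=\inf_{n\ge1}\frac1n\int_{\mathbb{R}/\mathbb{Z}}\ln\|A_n(x)\|\,dx$. *)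

theory Defs
  imports "HOL-Analysis.Analysis"
begin

definition int_congruent :: "real \<Rightarrow> real \<Rightarrow> bool" where
  "int_congruent x y \<longleftrightarrow> x - y \<in> \<int>"

lemma equivp_int_congruent: "equivp int_congruent"
proof (rule equivpI)
  show "reflp int_congruent"
    by (rule reflpI) (simp add: int_congruent_def)
  show "symp int_congruent"
    by (rule sympI) (metis int_congruent_def Ints_minus minus_diff_eq)
  show "transp int_congruent"
  proof (rule transpI)
    fix x y z assume "int_congruent x y" "int_congruent y z"
    then have "(x - y) + (y - z) \<in> \<int>"
      unfolding int_congruent_def by (rule Ints_add)
    then show "int_congruent x z"
      by (simp add: int_congruent_def)
  qed
qed

quotient_type circ = real / int_congruent
  by (rule equivp_int_congruent)

lift_definition circ_of :: "real \<Rightarrow> circ" is "\<lambda>x. x" .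

instantiation circ :: ab_group_add
begin

lift_definition zero_circ :: circ is "0 :: real" .

lift_definition plus_circ :: "circ \<Rightarrow> circ \<Rightarrow> circ" is "(+) :: real \<Rightarrow> real \<Rightarrow> real"
  unfolding int_congruent_def by (metis Ints_add add_diff_add)

lift_definition uminus_circ :: "circ \<Rightarrow> circ" is "uminus :: real \<Rightarrow> real"
  unfolding int_congruent_def by (metis Ints_minus minus_diff_minus)

definition minus_circ :: "circ \<Rightarrow> circ \<Rightarrow> circ" where
  "minus_circ a b = a + - b"

instance
proof
  fix a b c :: circ
  show "a + b + c = a + (b + c)"
    by transfer (simp add: int_congruent_def add.assoc)
  show "a + b = b + a"
    by transfer (simp add: int_congruent_def add.commute)
  show "0 + a = a"
    by transfer (simp add: int_congruent_def)
  show "- a + a = 0"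
    by transfer (simp add: int_congruent_def)
  show "a - b = a + - b"
    by (rule minus_circ_def)
qed

end

lemma circ_of_eq_iff: "circ_of x = circ_of y \<longleftrightarrow> x - y \<in> \<int>"
  by transfer (simp add: int_congruent_def)

lemma circ_of_add: "circ_of (x + y) = circ_of x + circ_of y"
  by transfer (simp add: int_congruent_def)

lemma surj_circ_of: "surj circ_of"
proof -
  have "\<exists>x. y = circ_of x" for y
    by transfer (metis Ints_0 diff_self int_congruent_def)
  then show ?thesis by (simp add: surj_def)
qed

text \<open>The topology is the quotient topology of the real line.\<close>

instantiation circ :: topological_space
begin

definition open_circ :: "circ set \<Rightarrow> bool" where
  "open_circ U \<longleftrightarrow> open (circ_of -` U)"

instance
  by standard (auto simp: open_circ_def vimage_Union)

end

text \<open>Real analyticity on the circle is analyticity of the 1-periodic lift: near each point the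
  lift is the sum of its convergent power series.\<close>

definition real_analytic_circ :: "(circ \<Rightarrow> real) \<Rightarrow> bool" where
  "real_analytic_circ f \<longleftrightarrow>
     (\<forall>x0. \<exists>r>0. \<exists>a :: nat \<Rightarrow> real. \<forall>x. \<bar>x - x0\<bar> < r \<longrightarrow>
        (\<lambda>n. a n * (x - x0) ^ n) sums f (circ_of x))"

definition max_period_denom :: "(circ \<Rightarrow> real) \<Rightarrow> nat" where
  "max_period_denom f =
     (GREATEST q. q > 0 \<and> (\<forall>x. f (x + circ_of (1 / real q)) = f x))"

lift_definition circ_exp :: "circ \<Rightarrow> complex" is "\<lambda>t. exp (2 * pi * \<i> * of_real t)"
proof -
  fix s t assume "int_congruent s t"
  then obtain n :: int where "s - t = of_int n"
    unfolding int_congruent_def by (elim Ints_cases)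
  then have "s = t + of_int n" by simp
  then have "2 * pi * \<i> * of_real s = 2 * pi * \<i> * of_real t + of_int (2 * n) * of_real pi * \<i>"
    by (simp add: algebra_simps)
  then show "exp (2 * pi * \<i> * of_real s) = exp (2 * pi * \<i> * of_real t)"
    unfolding exp_eq by (metis of_real_mult of_real_of_int_eq)
qed

text \<open>The product \<open>k x\<close> is only defined modulo 1, hence the factor \<open>circ_exp x powi k\<close>; in terms of
  a real representative this is the usual formula, see \<open>sampling_circ_of\<close>.\<close>

definition sampling :: "(circ \<Rightarrow> real) \<Rightarrow> int \<Rightarrow> circ \<Rightarrow> complex" where
  "sampling \<theta> k x = circ_exp x powi k * exp (2 * pi * \<i> * of_real (\<theta> x))"

lemma sampling_circ_of:
  "sampling \<theta> k (circ_of t) = exp (2 * pi * \<i> * of_real (of_int k * t + \<theta> (circ_of t)))"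
proof -
  have "circ_exp (circ_of t) = exp (2 * pi * \<i> * of_real t)"
    by transfer simp
  then have "circ_exp (circ_of t) powi k = exp (of_int k * (2 * pi * \<i> * of_real t))"
    by (simp add: exp_power_int)
  then show ?thesis
    by (simp add: sampling_def exp_add [symmetric] algebra_simps)
qed

text \<open>The choice of square root affects the cocycle only by a global sign.\<close>

definition szego_cocycle :: "complex \<Rightarrow> real \<Rightarrow> (circ \<Rightarrow> complex) \<Rightarrow> circ \<Rightarrow> complex^2^2" where
  "szego_cocycle E l v x = (1 - l\<^sup>2) powr (-1/2) *\<^sub>R
     vector [vector [csqrt E, - of_real l * cnj (v x) / csqrt E],
             vector [- of_real l * v x * csqrt E, 1 / csqrt E]]"

text \<open>\<open>((+) \<alpha> ^^ n) x\<close> is \<open>x + n \<alpha>\<close>, so the iterate is \<open>A (x + (n - 1) \<alpha>) ** \<dots> ** A x\<close>.\<close>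

primrec cocycle_iter :: "circ \<Rightarrow> (circ \<Rightarrow> complex^2^2) \<Rightarrow> nat \<Rightarrow> circ \<Rightarrow> complex^2^2" where
  "cocycle_iter \<alpha> A 0 x = mat 1"
| "cocycle_iter \<alpha> A (Suc n) x = A (((+) \<alpha> ^^ n) x) ** cocycle_iter \<alpha> A n x"

text \<open>\<open>onorm\<close> gives the operator norm for the Hermitian norm on \<open>\<complex>\<^sup>2\<close>. For continuous \<open>A\<close> with
  determinant 1 the limit exists by subadditivity and equals the infimum over \<open>n \<ge> 1\<close>.\<close>

definition lyapunov_exponent :: "circ \<Rightarrow> (circ \<Rightarrow> complex^2^2) \<Rightarrow> real" where
  "lyapunov_exponent \<alpha> A =
     lim (\<lambda>n. 1 / real n *
       integral {0..1} (\<lambda>t. ln (onorm (\<lambda>w. cocycle_iter \<alpha> A n (circ_of t) *v w))))"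

end

theory Submission
  imports Defs "HOL-Complex_Analysis.Complex_Analysis"
begin

text \<open>The theorem rests on what happens to the cocycle at \<open>\<lambda> = 1\<close>. Without its normalising factor
  \<open>(1 - \<lambda>\<^sup>2) powr (-1/2)\<close>, the Szego matrix then has rank one: with \<open>s = \<surd>E\<close> it is the column
  \<open>(1, - v(x))\<close> times the row \<open>(s, - 1 / (v(x) s))\<close>. Products of such matrices are products of the
  scalars \<open>s\<^sup>-\<^sup>1 (E + v(x) / v(x + \<alpha>))\<close>, so the unnormalised exponent at \<open>\<lambda> = 1\<close> is the integral of
  \<open>ln \<bar>E + v(x) / v(x + \<alpha>)\<bar>\<close>. This is finite unless the analytic function \<open>E + v(x) / v(x + \<alpha>)\<close>
  vanishes identically. Vanishing makes \<open>\<theta>(x - \<alpha>) - \<theta>(x)\<close> constant, hence zero because its mean is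
  zero; so \<open>\<alpha>\<close> is a period of \<open>\<theta>\<close>, and \<open>E\<close> is determined by \<open>\<alpha>\<close>. These finitely many parameters
  form the exceptional set (\<open>sampling_rotation_imp_exceptional\<close>).

  What must be shown is that the unnormalised exponent stays bounded below as \<open>\<lambda>\<close> tends to \<open>1\<close>, locally
  uniformly in \<open>(\<alpha>, E)\<close>. On the real line \<open>E + v(x) / v(x + \<alpha>)\<close> may have zeros, but \<open>v\<close> extends
  to a nonvanishing holomorphic function on a strip, and some horizontal line \<open>Im z = y1\<close> contains no
  zero at all. On that line the rank one picture is stable: for \<open>\<lambda>\<close> near \<open>1\<close> a thin cone around the
  column direction is invariant and vectors in it grow at least like \<open>(d / 4) ^ n\<close>
  (\<open>szego_orbit_lower\<close>). To return to the real line one uses that the mean of \<open>ln\<close> of the norm of a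
  vector of holomorphic functions over a horizontal line is a convex function of its height
  (\<open>convex_on_integral_ln_norm\<close>). With a trivial upper bound on a higher line \<open>Im z = y2\<close>,
  convexity at the heights \<open>0 < y1 < y2\<close> bounds the mean at height \<open>0\<close> from below, linearly in \<open>n\<close>
  and with constants that do not depend on \<open>\<lambda>\<close> (\<open>lyapunov_exponent_lower_bound\<close>). For \<open>\<lambda>\<close> away
  from \<open>1\<close> the exponent is nonnegative since the determinant is one, and compactness finishes the
  argument.

  On the exceptional set the second iterate of the cocycle is a diagonal unitary matrix, so all
  iterates are bounded and the exponent vanishes (\<open>lyapunov_exponent_eq_0_if_rotated\<close>).\<close>

section \<open>Convexity of logarithmic means over horizontal lines\<close>

abbreviation strip :: "real \<Rightarrow> complex set" where
  "strip \<rho> \<equiv> {z. \<bar>Im z\<bar> < \<rho>}"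

lemma open_strip: "open (strip \<rho>)"
proof -
  have "strip \<rho> = {z. Im z < \<rho>} \<inter> {z. Im z > - \<rho>}" by auto
  then show ?thesis
    by (simp add: open_halfspace_Im_lt open_halfspace_Im_gt open_Int)
qed

lemma convex_strip: "convex (strip \<rho>)"
proof -
  have "strip \<rho> = {z. Im z < \<rho>} \<inter> {z. Im z > - \<rho>}" by auto
  then show ?thesis
    by (simp add: convex_halfspace_Im_lt convex_halfspace_Im_gt convex_Int)
qed

lemma Complex_has_vector_derivative_x:
  "((\<lambda>x. Complex x y) has_vector_derivative 1) (at x within S)"
  unfolding Complex_eq by (auto intro!: derivative_eq_intros)

lemma Complex_has_vector_derivative_y:
  "((\<lambda>y. Complex x y) has_vector_derivative \<i>) (at y within S)"
  unfolding Complex_eq by (auto intro!: derivative_eq_intros)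

text \<open>The left side is the squared modulus of \<open>cnj f * f' + cnj g * g'\<close>, split into real and imaginary
  part, so this is the Cauchy--Schwarz inequality in \<open>\<complex>\<^sup>2\<close>.\<close>

lemma inner_plus_sum_squares_le:
  fixes f g f' g' :: complex
  shows "(inner f f' + inner g g')\<^sup>2 + (inner f (\<i> * f') + inner g (\<i> * g'))\<^sup>2
     \<le> ((cmod f)\<^sup>2 + (cmod g)\<^sup>2) * ((cmod f')\<^sup>2 + (cmod g')\<^sup>2)"
proof -
  have "inner f f' + inner g g' = Re (cnj f * f' + cnj g * g')"
    "inner f (\<i> * f') + inner g (\<i> * g') = - Im (cnj f * f' + cnj g * g')"
    by (simp_all add: inner_complex_def)
  then have "(inner f f' + inner g g')\<^sup>2 + (inner f (\<i> * f') + inner g (\<i> * g'))\<^sup>2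
      = (cmod (cnj f * f' + cnj g * g'))\<^sup>2"
    by (simp only: cmod_power2 power2_minus)
  also have "\<dots> \<le> (cmod f * cmod f' + cmod g * cmod g')\<^sup>2"
    by (intro power_mono) (metis complex_mod_cnj norm_mult norm_triangle_ineq, simp)
  also have "\<dots> \<le> ((cmod f)\<^sup>2 + (cmod g)\<^sup>2) * ((cmod f')\<^sup>2 + (cmod g')\<^sup>2)"
  proof -
    have "0 \<le> (cmod f * cmod g' - cmod g * cmod f')\<^sup>2" by simp
    then show ?thesis by (simp add: power2_eq_square algebra_simps)
  qed
  finally show ?thesis .
qed

text \<open>The function \<open>u = ln (\<bar>f\<bar>\<^sup>2 + \<bar>g\<bar>\<^sup>2)\<close> is smooth and subharmonic, the inequality \<open>\<Delta>u \<ge> 0\<close> being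
  Cauchy--Schwarz. By periodicity \<open>u\<^sub>x\<^sub>x\<close> has integral zero over a horizontal period, so the second
  derivative of the mean in the height \<open>y\<close> is the integral of \<open>u\<^sub>y\<^sub>y = \<Delta>u - u\<^sub>x\<^sub>x\<close>, which is
  nonnegative. A vector without zeros spares the singularities of the logarithm that a single
  function would have.\<close>

lemma convex_on_integral_ln_norm:
  fixes f g :: "complex \<Rightarrow> complex"
  assumes f: "f holomorphic_on strip \<rho>" and g: "g holomorphic_on strip \<rho>"
    and fp: "\<And>z. z \<in> strip \<rho> \<Longrightarrow> f (z + 1) = f z"
    and gp: "\<And>z. z \<in> strip \<rho> \<Longrightarrow> g (z + 1) = g z"
    and nz: "\<And>z. z \<in> strip \<rho> \<Longrightarrow> f z \<noteq> 0 \<or> g z \<noteq> 0"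
  shows "convex_on {-\<rho><..<\<rho>}
    (\<lambda>y. integral {0..1} (\<lambda>x. ln ((cmod (f (Complex x y)))\<^sup>2 + (cmod (g (Complex x y)))\<^sup>2)))"
proof -
  define f1 f2 g1 g2 where "f1 = deriv f" and "f2 = deriv f1" and "g1 = deriv g" and "g2 = deriv g1"
  have hol: "f1 holomorphic_on strip \<rho>" "f2 holomorphic_on strip \<rho>"
    "g1 holomorphic_on strip \<rho>" "g2 holomorphic_on strip \<rho>"
    unfolding f1_def f2_def g1_def g2_def
    by (intro holomorphic_deriv f g open_strip)+
  have D: "(f has_field_derivative f1 z) (at z)" "(f1 has_field_derivative f2 z) (at z)"
    "(g has_field_derivative g1 z) (at z)" "(g1 has_field_derivative g2 z) (at z)"
    if "z \<in> strip \<rho>" for z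
    using holomorphic_derivI[OF f open_strip that] holomorphic_derivI[OF hol(1) open_strip that]
      holomorphic_derivI[OF g open_strip that] holomorphic_derivI[OF hol(3) open_strip that]
    by (simp_all add: f1_def f2_def g1_def g2_def)
  \<comment> \<open>The real inner product on \<open>\<complex>\<close> makes the derivatives of \<open>P\<close> in the directions \<open>1\<close> and \<open>\<i>\<close> equal
      \<open>2 R\<close> and \<open>2 J\<close>; \<open>uxx\<close> and \<open>uyy\<close> are the second derivatives of \<open>ln P\<close>.\<close>
  define P where "P z = (cmod (f z))\<^sup>2 + (cmod (g z))\<^sup>2" for z
  define Q where "Q z = (cmod (f1 z))\<^sup>2 + (cmod (g1 z))\<^sup>2" for z
  define T where "T z = inner (f z) (f2 z) + inner (g z) (g2 z)" for z
  define R where "R z = inner (f z) (f1 z) + inner (g z) (g1 z)" for z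
  define J where "J z = inner (f z) (\<i> * f1 z) + inner (g z) (\<i> * g1 z)" for z
  define uyy where "uyy z = 2 * (Q z - T z) / P z - 4 * (J z)\<^sup>2 / (P z)\<^sup>2" for z
  define uxx where "uxx z = 2 * (Q z + T z) / P z - 4 * (R z)\<^sup>2 / (P z)\<^sup>2" for z
  have Ppos: "P z > 0" if "z \<in> strip \<rho>" for z
    using nz[OF that] unfolding P_def
    by (metis add_pos_nonneg add_nonneg_pos zero_le_power2 zero_less_norm_iff zero_less_power)
  have inS: "Complex x y \<in> strip \<rho>" if "y \<in> {-\<rho><..<\<rho>}" for x y
    using that by auto
  have Dx: "((\<lambda>x. F (Complex x y)) has_vector_derivative F' (Complex x y)) (at x)"
    and Dy: "((\<lambda>y. F (Complex x y)) has_vector_derivative \<i> * F' (Complex x y)) (at y)"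
    if "\<And>z. z \<in> strip \<rho> \<Longrightarrow> (F has_field_derivative F' z) (at z)" "y \<in> {-\<rho><..<\<rho>}"
    for F F' :: "complex \<Rightarrow> complex" and x y
    using field_vector_diff_chain_at[OF Complex_has_vector_derivative_x[of y x UNIV] that(1)[OF inS[OF that(2)]]]
      field_vector_diff_chain_at[OF Complex_has_vector_derivative_y[of x y UNIV] that(1)[OF inS[OF that(2)]]]
    by (simp_all add: o_def)
  note fx = Dx[of f f1, OF D(1)] and f1x = Dx[of f1 f2, OF D(2)]
    and gx = Dx[of g g1, OF D(3)] and g1x = Dx[of g1 g2, OF D(4)]
  note fy = Dy[of f f1, OF D(1)] and f1y = Dy[of f1 f2, OF D(2)]
    and gy = Dy[of g g1, OF D(3)] and g1y = Dy[of g1 g2, OF D(4)]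
  note inn = bounded_bilinear.has_vector_derivative[OF bounded_bilinear_inner]
  have nsq: "(cmod z)\<^sup>2 = inner z z" for z by (simp add: power2_norm_eq_inner)
  have Px: "((\<lambda>x. P (Complex x y)) has_real_derivative 2 * R (Complex x y)) (at x)"
    and Py: "((\<lambda>y. P (Complex x y)) has_real_derivative 2 * J (Complex x y)) (at y)"
    if "y \<in> {-\<rho><..<\<rho>}" for x y
    unfolding P_def nsq R_def J_def has_real_derivative_iff_has_vector_derivative
    by (rule derivative_eq_intros inn fx gx fy gy that refl | simp add: inner_commute)+
  have Rx: "((\<lambda>x. R (Complex x y)) has_real_derivative (Q (Complex x y) + T (Complex x y))) (at x)"
    if "y \<in> {-\<rho><..<\<rho>}" for x y
    unfolding R_def Q_def nsq T_def has_real_derivative_iff_has_vector_derivative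
    by (rule derivative_eq_intros inn fx gx f1x g1x that refl | simp)+
  have Jy: "((\<lambda>y. J (Complex x y)) has_real_derivative (Q (Complex x y) - T (Complex x y))) (at y)"
    if "y \<in> {-\<rho><..<\<rho>}" for x y
    unfolding J_def Q_def nsq T_def has_real_derivative_iff_has_vector_derivative
    by (rule derivative_eq_intros inn fy gy that refl
          has_vector_derivative_mult_right[OF f1y] has_vector_derivative_mult_right[OF g1y]
        | simp add: inner_complex_def algebra_simps)+
  have u_y: "((\<lambda>y. ln (P (Complex x y))) has_real_derivative 2 * J (Complex x y) / P (Complex x y)) (at y)"
    and u_yy: "((\<lambda>y. 2 * J (Complex x y) / P (Complex x y)) has_real_derivative uyy (Complex x y)) (at y)"
    and u_xx: "((\<lambda>x. 2 * R (Complex x y) / P (Complex x y)) has_real_derivative uxx (Complex x y)) (at x)"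
    if y: "y \<in> {-\<rho><..<\<rho>}" for x y
    using Ppos[OF inS[OF y], of x]
    by (auto intro!: derivative_eq_intros Px Py Rx Jy y simp: uyy_def uxx_def field_simps power2_eq_square)
  have sub: "uyy z + uxx z \<ge> 0" if "z \<in> strip \<rho>" for z
  proof -
    have "(R z)\<^sup>2 + (J z)\<^sup>2 \<le> P z * Q z"
      unfolding R_def J_def P_def Q_def by (rule inner_plus_sum_squares_le)
    moreover have "uyy z + uxx z = 4 * (P z * Q z - ((R z)\<^sup>2 + (J z)\<^sup>2)) / (P z)\<^sup>2"
      using Ppos[OF that] by (simp add: uyy_def uxx_def field_simps power2_eq_square)
    ultimately show ?thesis by simp
  qed
  have per: "R (Complex 1 y) = R (Complex 0 y)" "P (Complex 1 y) = P (Complex 0 y)"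
    if y: "y \<in> {-\<rho><..<\<rho>}" for y
  proof -
    have e: "Complex 0 y + 1 = Complex 1 y" by (simp add: complex_eq_iff)
    have der: "deriv F (Complex 1 y) = deriv F (Complex 0 y)"
      if Fp: "\<And>z. z \<in> strip \<rho> \<Longrightarrow> F (z + 1) = F z" and F: "F holomorphic_on strip \<rho>"
      for F :: "complex \<Rightarrow> complex"
    proof -
      have "eventually (\<lambda>z. F (z + 1) = F z) (nhds (Complex 0 y))"
        using Fp eventually_nhds_in_open[OF open_strip inS[OF y, of 0]] by (auto elim!: eventually_mono)
      then have "deriv (\<lambda>z. F (z + 1)) (Complex 0 y) = deriv F (Complex 0 y)"
        by (rule deriv_cong_ev) simp
      moreover have "deriv (\<lambda>z. F (z + 1)) (Complex 0 y) = deriv F (Complex 1 y)"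
        using holomorphic_derivI[OF F open_strip inS[OF y, of 1]]
        by (metis DERIV_imp_deriv DERIV_shift e)
      ultimately show ?thesis by simp
    qed
    show "R (Complex 1 y) = R (Complex 0 y)" "P (Complex 1 y) = P (Complex 0 y)"
      using fp[OF inS[OF y, of 0]] gp[OF inS[OF y, of 0]] der[OF fp f] der[OF gp g]
      by (simp_all add: R_def P_def e f1_def g1_def)
  qed
  have contS: "continuous_on (strip \<rho>) f" "continuous_on (strip \<rho>) f1" "continuous_on (strip \<rho>) f2"
     "continuous_on (strip \<rho>) g" "continuous_on (strip \<rho>) g1" "continuous_on (strip \<rho>) g2"
    using f g hol by (auto intro: holomorphic_on_imp_continuous_on)
  have cP: "continuous_on (strip \<rho>) P" and cJ: "continuous_on (strip \<rho>) J"
    and cQ: "continuous_on (strip \<rho>) Q" and cT: "continuous_on (strip \<rho>) T" and cR: "continuous_on (strip \<rho>) R"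
    unfolding P_def J_def Q_def T_def R_def by (intro continuous_intros contS)+
  have cu: "continuous_on (strip \<rho>) (\<lambda>z. ln (P z))" "continuous_on (strip \<rho>) (\<lambda>z. 2 * J z / P z)"
    "continuous_on (strip \<rho>) uyy" "continuous_on (strip \<rho>) uxx"
    unfolding uyy_def uxx_def
    by (intro continuous_intros cP cJ cQ cT cR; use Ppos in force)+
  have cpair: "continuous_on ({-\<rho><..<\<rho>} \<times> cbox 0 1) (\<lambda>(y, x). F (Complex x y))"
    if "continuous_on (strip \<rho>) F" for F :: "complex \<Rightarrow> real"
    unfolding case_prod_unfold Complex_eq
    by (rule continuous_on_compose2[OF that]) (auto intro!: continuous_intros)
  have cline: "continuous_on {0..1} (\<lambda>x. F (Complex x y))"
    if "continuous_on (strip \<rho>) F" "y \<in> {-\<rho><..<\<rho>}" for F :: "complex \<Rightarrow> real" and y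
    unfolding case_prod_unfold Complex_eq
    by (rule continuous_on_compose2[OF that(1)]) (use that(2) in \<open>auto intro!: continuous_intros\<close>)
  have D1: "((\<lambda>y. integral {0..1} (\<lambda>x. ln (P (Complex x y)))) has_real_derivative
      integral {0..1} (\<lambda>x. 2 * J (Complex x y) / P (Complex x y))) (at y)" if y: "y \<in> {-\<rho><..<\<rho>}" for y
  proof -
    have "((\<lambda>y. integral (cbox 0 1) (\<lambda>x. ln (P (Complex x y)))) has_real_derivative
      integral (cbox 0 1) (\<lambda>x. 2 * J (Complex x y) / P (Complex x y))) (at y within {-\<rho><..<\<rho>})"
      by (rule leibniz_rule_field_derivative[OF u_y[THEN has_field_derivative_at_within] _ cpair[OF cu(2)] y])
         (auto intro!: integrable_continuous_real cline[OF cu(1)])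
    then show ?thesis by (simp add: at_within_open[OF y])
  qed
  have D2: "((\<lambda>y. integral {0..1} (\<lambda>x. 2 * J (Complex x y) / P (Complex x y))) has_real_derivative
      integral {0..1} (\<lambda>x. uyy (Complex x y))) (at y)" if y: "y \<in> {-\<rho><..<\<rho>}" for y
  proof -
    have "((\<lambda>y. integral (cbox 0 1) (\<lambda>x. 2 * J (Complex x y) / P (Complex x y))) has_real_derivative
      integral (cbox 0 1) (\<lambda>x. uyy (Complex x y))) (at y within {-\<rho><..<\<rho>})"
      by (rule leibniz_rule_field_derivative[OF u_yy[THEN has_field_derivative_at_within] _ cpair[OF cu(3)] y])
         (auto intro!: integrable_continuous_real cline[OF cu(2)])
    then show ?thesis by (simp add: at_within_open[OF y])
  qed
  have D2nonneg: "integral {0..1} (\<lambda>x. uyy (Complex x y)) \<ge> 0" if y: "y \<in> {-\<rho><..<\<rho>}" for y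
  proof -
    have "((\<lambda>x. uxx (Complex x y)) has_integral
        (2 * R (Complex 1 y) / P (Complex 1 y) - 2 * R (Complex 0 y) / P (Complex 0 y))) {0..1}"
      by (rule fundamental_theorem_of_calculus)
        (auto simp: has_real_derivative_iff_has_vector_derivative[symmetric]
           intro!: has_field_derivative_at_within u_xx y)
    then have "integral {0..1} (\<lambda>x. uxx (Complex x y)) = 0"
      by (simp add: per[OF y] integral_unique)
    moreover have "integral {0..1} (\<lambda>x. uyy (Complex x y)) + integral {0..1} (\<lambda>x. uxx (Complex x y))
      = integral {0..1} (\<lambda>x. uyy (Complex x y) + uxx (Complex x y))"
      by (intro integral_add[symmetric] integrable_continuous_real cline[OF cu(3) y] cline[OF cu(4) y])
    moreover have "\<dots> \<ge> 0"
      by (intro integral_nonneg integrable_continuous_real continuous_on_add cline[OF cu(3) y] cline[OF cu(4) y]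
          sub inS y)
    ultimately show ?thesis by simp
  qed
  have "convex_on {-\<rho><..<\<rho>} (\<lambda>y. integral {0..1} (\<lambda>x. ln (P (Complex x y))))"
    by (rule f''_ge0_imp_convex[OF _ D1 D2 D2nonneg]) auto
  then show ?thesis by (simp add: P_def)
qed

section \<open>Holomorphic extension of real analytic functions on the circle\<close>

lemma circ_of_plus_of_int [simp]: "circ_of (x + of_int n) = circ_of x"
  by (simp add: circ_of_eq_iff)

lemma circ_of_plus_1 [simp]: "circ_of (x + 1) = circ_of x"
  using circ_of_plus_of_int[of x 1] by simp

lemma real_analytic_local_extension:
  fixes h :: "real \<Rightarrow> real"
  assumes "r > 0" and "\<And>x. \<bar>x - x0\<bar> < r \<Longrightarrow> (\<lambda>n. a n * (x - x0) ^ n) sums h x"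
  obtains g where "g holomorphic_on ball (of_real x0) r"
    "\<And>x. of_real x \<in> ball (of_real x0 :: complex) r \<Longrightarrow> g (of_real x) = of_real (h x)"
proof
  define g :: "complex \<Rightarrow> complex" where "g z = (\<Sum>n. of_real (a n) * (z - of_real x0) ^ n)" for z
  have s: "(\<lambda>n. of_real (a n) * (z - of_real x0) ^ n) sums g z" if z: "z \<in> ball (of_real x0) r" for z
  proof -
    define s where "s = (norm (z - of_real x0) + r) / 2"
    have s: "norm (z - of_real x0) < s" "s < r" "s > 0"
      using z \<open>r > 0\<close> by (auto simp: s_def dist_norm norm_minus_commute intro: add_nonneg_pos)
    have "summable (\<lambda>n. a n * s ^ n)"
      using assms(2)[of "x0 + s"] s sums_summable by auto
    then have "summable (\<lambda>n. complex_of_real (a n * s ^ n))"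
      by (subst summable_complex_of_real)
    then have "summable (\<lambda>n. of_real (a n) * (complex_of_real s) ^ n)"
      by simp
    then have "summable (\<lambda>n. of_real (a n) * (z - of_real x0) ^ n)"
      by (rule powser_inside) (use s in auto)
    then show ?thesis unfolding g_def by (rule summable_sums)
  qed
  show "g holomorphic_on ball (of_real x0) r"
    by (rule power_series_holomorphic) (rule s)
  fix x assume x: "of_real x \<in> ball (of_real x0 :: complex) r"
  then have "\<bar>x - x0\<bar> < r"
    by (simp add: dist_norm abs_minus_commute flip: of_real_diff)
  then have "(\<lambda>n. a n * (x - x0) ^ n) sums h x" by (rule assms(2))
  then have "(\<lambda>n. complex_of_real (a n * (x - x0) ^ n)) sums of_real (h x)"
    by (simp only: sums_of_real_iff)
  then show "g (of_real x) = of_real (h x)"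
    using s[OF x] by (simp add: sums_unique2)
qed

text \<open>A real point of \<open>S\<close> is a limit of real points of \<open>S\<close>, so this is the identity theorem.\<close>

lemma holomorphic_eq_if_eq_on_reals:
  assumes f: "f holomorphic_on S" and g: "g holomorphic_on S" and S: "open S" "connected S"
    and x0: "of_real x0 \<in> S" and eq: "\<And>x. of_real x \<in> S \<Longrightarrow> f (of_real x) = g (of_real x)"
    and z: "z \<in> S"
  shows "f z = g z"
proof -
  obtain e where e: "e > 0" "ball (of_real x0) e \<subseteq> S"
    using S(1) x0 openE by blast
  define U where "U = S \<inter> \<real>"
  have "of_real x0 islimpt U"
    unfolding islimpt_approachable
  proof (intro allI impI)
    fix d :: real assume d: "d > 0"
    define t where "t = min d e / 2"
    have t: "t > 0" "t < d" "t < e" using d e by (auto simp: t_def)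
    have "of_real (x0 + t) \<in> ball (complex_of_real x0) e" using t by (simp add: dist_norm)
    then have "of_real (x0 + t) \<in> U" using e by (auto simp: U_def simp del: of_real_add)
    moreover have "of_real (x0 + t) \<noteq> complex_of_real x0" "dist (of_real (x0 + t)) (complex_of_real x0) < d"
      using t by (simp_all add: dist_norm)
    ultimately show "\<exists>x'\<in>U. x' \<noteq> complex_of_real x0 \<and> dist x' (complex_of_real x0) < d" by blast
  qed
  then have "f z - g z = 0"
    by (rule analytic_continuation[where f="\<lambda>z. f z - g z" and U=U and \<xi>="of_real x0", rotated 5])
      (use assms in \<open>auto simp: U_def Reals_def intro!: holomorphic_intros\<close>)
  then show ?thesis by simp
qed

text \<open>The local power series converge on complex discs around real points. Compactness of a period gives a
  common radius \<open>\<rho>\<close>, and the identity theorem makes the local extensions agree on overlaps, which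
  are convex and symmetric about the real line.\<close>

lemma real_analytic_circ_holomorphic_extension:
  assumes "real_analytic_circ \<theta>"
  shows "\<exists>\<rho>>0. \<exists>\<Theta>. \<Theta> holomorphic_on strip \<rho> \<and> (\<forall>t. \<Theta> (of_real t) = of_real (\<theta> (circ_of t)))
    \<and> (\<forall>z\<in>strip \<rho>. \<Theta> (z + 1) = \<Theta> z)"
proof -
  define h where "h t = \<theta> (circ_of t)" for t
  define ext where "ext x r g \<longleftrightarrow> g holomorphic_on ball (complex_of_real x) r \<and>
    (\<forall>t. of_real t \<in> ball (complex_of_real x) r \<longrightarrow> g (of_real t) = of_real (h t))" for x r g
  have "\<exists>r>0. \<exists>g. ext x r g" for x
  proof -
    obtain r a where "r > 0" "\<And>t. \<bar>t - x\<bar> < r \<Longrightarrow> (\<lambda>n. a n * (t - x) ^ n) sums h t"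
      using assms unfolding real_analytic_circ_def h_def by blast
    moreover from this obtain g where "ext x r g"
      unfolding ext_def by (rule real_analytic_local_extension) blast+
    ultimately show ?thesis by blast
  qed
  then obtain r where r: "\<And>x. r x > 0" "\<And>x. \<exists>g. ext x (r x) g" by metis
  obtain \<rho> where \<rho>: "\<rho> > 0"
    "\<And>x. x \<in> of_real ` {0..1} \<Longrightarrow> \<exists>G\<in>range (\<lambda>y. ball (complex_of_real y) (r y)). ball x \<rho> \<subseteq> G"
  proof (rule Heine_Borel_lemma[of "complex_of_real ` {0..1}" "range (\<lambda>y. ball (complex_of_real y) (r y))"])
    show "compact (complex_of_real ` {0..1})"
      by (intro compact_continuous_image continuous_intros compact_Icc)
    show "complex_of_real ` {0..1} \<subseteq> \<Union>(range (\<lambda>y. ball (complex_of_real y) (r y)))"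
    proof (rule subsetI, elim imageE)
      fix z :: complex and t :: real assume "z = of_real t"
      then have "z \<in> ball (complex_of_real t) (r t)" using r(1) by simp
      then show "z \<in> \<Union>(range (\<lambda>y. ball (complex_of_real y) (r y)))" by blast
    qed
  qed auto
  have "\<exists>g. ext x \<rho> g" for x
  proof -
    define n where "n = floor x"
    have "of_real (x - of_int n) \<in> complex_of_real ` {0..1}"
      by (rule imageI) (simp add: n_def, linarith)
    then obtain y where y: "ball (of_real (x - of_int n)) \<rho> \<subseteq> ball (complex_of_real y) (r y)"
      using \<rho>(2) by blast
    obtain g where g: "ext y (r y) g" using r(2) by blast
    have sh: "z - of_int n \<in> ball (of_real (x - of_int n)) \<rho>" if "z \<in> ball (of_real x) \<rho>" for z :: complex
      using that by (simp add: dist_norm)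
    have "ext x \<rho> (\<lambda>z. g (z - of_int n))"
      unfolding ext_def
    proof (intro conjI allI impI)
      have "g holomorphic_on ball (of_real (x - of_int n)) \<rho>"
        using g y unfolding ext_def by (meson holomorphic_on_subset)
      then show "(\<lambda>z. g (z - of_int n)) holomorphic_on ball (complex_of_real x) \<rho>"
        by (rule holomorphic_on_compose_gen[where f="\<lambda>z. z - of_int n", unfolded o_def, rotated])
          (use sh in \<open>auto intro!: holomorphic_intros\<close>)
      fix t assume "complex_of_real t \<in> ball (complex_of_real x) \<rho>"
      from sh[OF this] y have "of_real (t - of_int n) \<in> ball (complex_of_real y) (r y)" by auto
      then have "g (of_real (t - of_int n)) = of_real (h (t - of_int n))"
        using g unfolding ext_def by blast
      moreover have "h (t - of_int n) = h t"
        using circ_of_plus_of_int[of t "-n"] by (simp add: h_def)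
      ultimately show "g (of_real t - of_int n) = of_real (h t)" by simp
    qed
    then show ?thesis by blast
  qed
  then obtain g where g: "\<And>x. ext x \<rho> (g x)" by metis
  \<comment> \<open>Glue by using at \<open>z\<close> the extension centred at the real part of \<open>z\<close>.\<close>
  define \<Theta> where "\<Theta> z = g (Re z) z" for z
  have loc: "\<Theta> z = g x z" if z: "z \<in> ball (of_real x) \<rho>" "z \<in> strip \<rho>" for x z
    unfolding \<Theta>_def
  proof (rule holomorphic_eq_if_eq_on_reals[where f="g (Re z)" and z=z and S="ball (of_real (Re z)) \<rho> \<inter> ball (of_real x) \<rho>" and ?x0.0 = "Re z"])
    show "of_real (Re z) \<in> ball (complex_of_real (Re z)) \<rho> \<inter> ball (complex_of_real x) \<rho>"
    proof -
      have "\<bar>Re z - x\<bar> \<le> cmod (z - of_real x)"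
        using abs_Re_le_cmod[of "z - of_real x"] by simp
      then show ?thesis using \<rho>(1) z(1)
        by (simp add: dist_norm norm_minus_commute flip: of_real_diff)
    qed
    have "cmod (of_real (Re z) - z) = \<bar>Im z\<bar>"
      by (simp add: cmod_def)
    then show "z \<in> ball (complex_of_real (Re z)) \<rho> \<inter> ball (complex_of_real x) \<rho>"
      using z by (simp add: dist_norm)
    show "connected (ball (complex_of_real (Re z)) \<rho> \<inter> ball (complex_of_real x) \<rho>)"
      by (intro convex_connected convex_Int convex_ball)
  qed (use g in \<open>auto simp: ext_def intro: holomorphic_on_subset\<close>)
  have hol: "\<Theta> holomorphic_on strip \<rho>"
  proof (rule holomorphic_on_open[OF open_strip, THEN iffD2], intro ballI)
    fix z assume z: "z \<in> strip \<rho>"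
    have cm: "cmod (of_real (Re z) - z) = \<bar>Im z\<bar>" by (simp add: cmod_def)
    have zb: "z \<in> ball (of_real (Re z)) \<rho> \<inter> strip \<rho>" using z cm by (simp add: dist_norm)
    have "g (Re z) holomorphic_on ball (of_real (Re z)) \<rho> \<inter> strip \<rho>"
      using g[of "Re z"] unfolding ext_def by (meson holomorphic_on_subset inf_le1)
    then have "\<Theta> holomorphic_on ball (of_real (Re z)) \<rho> \<inter> strip \<rho>"
      by (rule holomorphic_transform) (use loc in auto)
    then show "\<exists>f'. (\<Theta> has_field_derivative f') (at z)"
      using zb open_strip by (metis holomorphic_derivI open_Int open_ball)
  qed
  have real: "\<Theta> (of_real t) = of_real (h t)" for t
    using g[of t] \<rho>(1) by (simp add: \<Theta>_def ext_def)
  have "\<Theta> (z + 1) = \<Theta> z" if z: "z \<in> strip \<rho>" for z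
  proof (rule holomorphic_eq_if_eq_on_reals[where f="\<lambda>z. \<Theta> (z + 1)", OF _ hol open_strip _ _ _ z])
    show "(\<lambda>z. \<Theta> (z + 1)) holomorphic_on strip \<rho>"
      by (rule holomorphic_on_compose_gen[where f="\<lambda>z. z + 1", OF _ hol, unfolded o_def])
        (auto intro!: holomorphic_intros)
    show "connected (strip \<rho>)" by (rule convex_connected[OF convex_strip])
    show "of_real 0 \<in> strip \<rho>" using \<rho> by simp
    show "\<Theta> (of_real x + 1) = \<Theta> (of_real x)" for x
      using real[of "x+1"] real[of x] by (simp add: h_def)
  qed
  then show ?thesis using \<rho>(1) hol real unfolding h_def by blast
qed

section \<open>Periods of functions on the circle\<close>

lemma circ_period_iff:
  "(\<forall>x. f (x + circ_of t) = f x) \<longleftrightarrow> (\<forall>x. f (circ_of (x + t)) = f (circ_of x))"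
  by (metis circ_of_add surj_circ_of surjD)

text \<open>If there were arbitrarily small periods, multiples of them would bring any point arbitrarily close to
  any other without changing the value of \<open>h\<close>.\<close>

lemma continuous_nonconstant_period_gap:
  fixes h :: "real \<Rightarrow> 'a::metric_space"
  assumes cont: "continuous_on UNIV h" and nonconst: "\<not> h constant_on UNIV"
  obtains e where "e > 0" "\<And>t. 0 < t \<Longrightarrow> t < e \<Longrightarrow> \<not> (\<forall>x. h (x + t) = h x)"
proof (rule ccontr)
  assume "\<not> thesis"
  then have small: "\<exists>t>0. t < e \<and> (\<forall>x. h (x + t) = h x)" if "e > 0" for e
    using that \<open>\<And>e. \<lbrakk>0 < e; \<And>t. 0 < t \<Longrightarrow> t < e \<Longrightarrow> \<not> (\<forall>x. h (x + t) = h x)\<rbrakk> \<Longrightarrow> thesis\<close> by blast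
  have "h x = h y" for x y
  proof (rule ccontr)
    assume "h x \<noteq> h y"
    then obtain d where d: "d > 0" "\<And>z. dist z y < d \<Longrightarrow> dist (h z) (h y) < dist (h x) (h y)"
      using cont[unfolded continuous_on_iff] by (metis UNIV_I zero_less_dist_iff)
    obtain t where t: "t > 0" "t < d" "\<And>x. h (x + t) = h x" using small[OF d(1)] by blast
    have nat: "h (x + real n * t) = h x" for x n
      by (induction n) (use t(3)[of "x + real n * t" for n] in \<open>simp_all add: algebra_simps\<close>)
    have int: "h (x + of_int n * t) = h x" for x n
      using nat[of x "nat n"] nat[of "x + of_int n * t" "nat (- n)"] by (cases "n \<ge> 0") auto
    define n where "n = floor ((y - x) / t)"
    have "of_int n * t \<le> y - x" "y - x < (of_int n + 1) * t"
      using t(1) by (simp_all add: n_def flip: pos_le_divide_eq pos_divide_less_eq)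
    then have "dist (x + of_int n * t) y < d" using t(2) by (simp add: dist_real_def algebra_simps)
    from d(2)[OF this] show False by (simp add: int)
  qed
  then show False using nonconst unfolding constant_on_def by blast
qed

text \<open>The real periods of a nonconstant function on the circle form a discrete group containing
  \<open>1\<close>, hence the group of multiples of its least positive element, which has the form \<open>1 / q\<close>.\<close>

lemma period_multiple_of_max_period_denom:
  fixes f :: "circ \<Rightarrow> real"
  assumes cont: "continuous_on UNIV (\<lambda>t. f (circ_of t))" and nonconst: "\<not> f constant_on UNIV"
  shows "max_period_denom f > 0"
    and "f (x + circ_of (1 / real (max_period_denom f))) = f x"
    and "(\<And>x. f (x + circ_of t) = f x) \<Longrightarrow> \<exists>n::int. t = of_int n / real (max_period_denom f)"
proof -
  define h where "h t = f (circ_of t)" for t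
  have "\<not> h constant_on UNIV"
  proof
    assume "h constant_on UNIV"
    then obtain c where c: "\<And>t. f (circ_of t) = c" by (auto simp: constant_on_def h_def)
    have "f y = c" for y using c surjD[OF surj_circ_of, of y] by auto
    then show False using nonconst by (auto simp: constant_on_def)
  qed
  from continuous_nonconstant_period_gap[OF cont[folded h_def] this] obtain e where e: "e > 0" "\<And>t. 0 < t \<Longrightarrow> t < e \<Longrightarrow> \<not> (\<forall>x. h (x + t) = h x)"
    by blast
  define G where "G = {t. \<forall>x. h (x + t) = h x}"
  have Gf: "t \<in> G \<longleftrightarrow> (\<forall>x. f (x + circ_of t) = f x)" for t
    unfolding G_def h_def circ_period_iff by simp
  have G1: "1 \<in> G" by (simp add: G_def h_def)
  have Gdiff: "s - t \<in> G" if "s \<in> G" "t \<in> G" for s t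
  proof -
    have "h (x + (s - t)) = h x" for x
      using that(1)[unfolded G_def, simplified, THEN spec, of "x - t"] that(2)[unfolded G_def, simplified, THEN spec, of "x - t"]
      by (simp add: algebra_simps)
    then show ?thesis by (simp add: G_def)
  qed
  have G0: "0 \<in> G" by (simp add: G_def)
  have Gnat: "real n * t \<in> G" if "t \<in> G" for n t
  proof (induction n)
    case (Suc n)
    then show ?case using Gdiff[OF that Gdiff[OF G0 Suc]] by (simp add: algebra_simps)
  qed (simp add: G0)
  have Gint: "of_int n * t \<in> G" if "t \<in> G" for n t
    using Gnat[OF that, of "nat n"] Gdiff[OF G0 Gnat[OF that, of "nat (- n)"]] by (cases "n \<ge> 0") auto
  have gap: "s = t" if "s \<in> G" "t \<in> G" "\<bar>s - t\<bar> < e" for s t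
  proof -
    have "\<not> 0 < s - t" "\<not> 0 < t - s"
      using e(2)[of "s - t"] e(2)[of "t - s"] Gdiff[of s t] Gdiff[of t s] that by (auto simp: G_def)
    then show ?thesis by simp
  qed
  define S where "S = G \<inter> {0<..1}"
  have "finite S"
  proof (rule finite_imageD)
    \<comment> \<open>Distinct periods are at least \<open>e\<close> apart, so \<open>floor (t / e)\<close> separates them.\<close>
    show "finite ((\<lambda>t. floor (t / e)) ` S)"
    proof (rule finite_subset)
      show "(\<lambda>t. floor (t / e)) ` S \<subseteq> {0..floor (1 / e)}"
        using e(1) by (auto simp: S_def intro!: floor_mono divide_right_mono)
    qed simp
    show "inj_on (\<lambda>t. floor (t / e)) S"
    proof (rule inj_onI)
      fix s t assume st: "s \<in> S" "t \<in> S" and eq: "floor (s / e) = floor (t / e)"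
      have "\<bar>s / e - t / e\<bar> < 1" using eq by linarith
      then have "\<bar>s - t\<bar> < e" using e(1) by (simp add: abs_less_iff field_simps)
      then show "s = t" using gap st by (simp add: S_def)
    qed
  qed
  moreover have "1 \<in> S" using G1 by (simp add: S_def)
  ultimately have gS: "Min S \<in> S" and gmin: "\<And>t. t \<in> S \<Longrightarrow> Min S \<le> t"
    by (auto intro!: Min_in)
  define g where "g = Min S"
  have g: "g > 0" "g \<in> G" "\<And>t. t \<in> G \<Longrightarrow> 0 < t \<Longrightarrow> g \<le> t"
  proof -
    show "g > 0" "g \<in> G" using gS by (simp_all add: g_def S_def)
    have "g \<le> 1" using gS by (simp add: g_def S_def)
    then show "g \<le> t" if "t \<in> G" "0 < t" for t
      using gmin[of t] that unfolding g_def S_def by (cases "t \<le> 1") auto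
  qed
  have mult: "\<exists>n::int. t = of_int n * g" if t: "t \<in> G" for t
  proof -
    define n where "n = floor (t / g)"
    have "of_int n \<le> t / g" "t / g < of_int n + 1" by (simp_all add: n_def)
    then have "0 \<le> t - of_int n * g" "t - of_int n * g < g" using g(1) by (simp_all add: field_simps)
    moreover have "t - of_int n * g \<in> G" by (rule Gdiff[OF t Gint[OF g(2)]])
    ultimately have "t - of_int n * g = 0" using g(3)[of "t - of_int n * g"] by linarith
    then show ?thesis by auto
  qed
  obtain m' :: int where m': "1 = of_int m' * g" using mult[OF G1] by blast
  then have "of_int m' > (0::real)" using g(1) by (metis zero_less_mult_pos2 zero_less_one)
  then obtain m :: nat where m: "m > 0" "m' = int m" by (metis of_int_0_less_iff zero_less_imp_eq_int)
  have gm: "g = 1 / real m" using m' m by (simp add: field_simps)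
  have q: "max_period_denom f = m"
    unfolding max_period_denom_def
  proof (rule Greatest_equality)
    show "m > 0 \<and> (\<forall>x. f (x + circ_of (1 / real m)) = f x)" using m g(2) Gf gm by simp
    fix k assume k: "k > 0 \<and> (\<forall>x. f (x + circ_of (1 / real k)) = f x)"
    then have "g \<le> 1 / real k" using g(3) Gf by simp
    then show "k \<le> m" using k m(1) gm by (simp add: field_simps)
  qed
  show "max_period_denom f > 0" using q m by simp
  show "f (x + circ_of (1 / real (max_period_denom f))) = f x" using g(2) Gf gm q by simp
  show "\<exists>n::int. t = of_int n / real (max_period_denom f)" if "\<And>x. f (x + circ_of t) = f x"
    using mult[of t] Gf that gm q by auto
qed

text \<open>A real period is an integer multiple of \<open>1 / q\<close>; on the circle the integer only matters modulo \<open>q\<close>.\<close>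

lemma period_eq_fraction:
  fixes f :: "circ \<Rightarrow> real"
  assumes cont: "continuous_on UNIV (\<lambda>t. f (circ_of t))" and nonconst: "\<not> f constant_on UNIV"
    and per: "\<And>x. f (x + circ_of t) = f x"
  obtains p where "p < max_period_denom f" "circ_of t = circ_of (real p / real (max_period_denom f))"
proof -
  let ?q = "max_period_denom f"
  have q: "?q > 0" by (rule period_multiple_of_max_period_denom[OF cont nonconst])
  obtain n :: int where n: "t = of_int n / real ?q"
    using period_multiple_of_max_period_denom(3)[OF cont nonconst per] by blast
  define p where "p = nat (n mod int ?q)"
  have p: "int p = n mod int ?q" using q by (simp add: p_def)
  have "p < ?q" using p q by (metis of_nat_0_less_iff of_nat_less_iff pos_mod_bound)
  moreover have "t = real p / real ?q + of_int (n div int ?q)"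
  proof -
    have "of_int n = (of_int (n mod int ?q) + of_int (n div int ?q) * real ?q :: real)"
      by (metis mod_mult_div_eq mult.commute of_int_add of_int_mult of_int_of_nat_eq)
    then show ?thesis unfolding n p[symmetric] using q by (simp add: field_simps)
  qed
  ultimately show ?thesis using that by (metis circ_of_plus_of_int)
qed

lemma fraction_is_period:
  fixes f :: "circ \<Rightarrow> real"
  assumes "continuous_on UNIV (\<lambda>t. f (circ_of t))" and "\<not> f constant_on UNIV"
  shows "f (x + circ_of (real p / real (max_period_denom f))) = f x"
proof (induction p)
  case 0
  have "circ_of 0 = 0" by (simp add: zero_circ_def circ_of_def)
  then show ?case by simp
next
  case (Suc p)
  let ?q = "max_period_denom f"
  have eq: "x + circ_of (real (Suc p) / real ?q) = (x + circ_of (real p / real ?q)) + circ_of (1 / real ?q)"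
    by (simp add: add.assoc add_divide_distrib add.commute flip: circ_of_add)
  show ?case by (simp only: eq period_multiple_of_max_period_denom(2)[OF assms] Suc)
qed

section \<open>Subadditive sequences and integrals of periodic functions\<close>

text \<open>This is Fekete's lemma: writing \<open>n = q m + r\<close> with \<open>r < m\<close> bounds \<open>a n / n\<close> by \<open>a m / m\<close> up to an
  error of order \<open>1 / n\<close>, so the quotients converge to their infimum.\<close>

lemma subadditive_convergent:
  fixes a :: "nat \<Rightarrow> real"
  assumes sub: "\<And>m n. a (m + n) \<le> a m + a n" and nonneg: "\<And>n. a n \<ge> 0"
  shows "convergent (\<lambda>n. a n / real n)"
proof -
  define L where "L = (INF n\<in>{1..}. a n / real n)"
  have bdd: "bdd_below ((\<lambda>n. a n / real n) ` {1..})"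
    by (intro bdd_belowI[of _ 0]) (auto simp: nonneg)
  have lower: "L \<le> a n / real n" if "n \<ge> 1" for n
    unfolding L_def by (rule cINF_lower[OF bdd]) (use that in auto)
  have mult: "a (q * m + r) \<le> real q * a m + a r" for q m r
  proof (induction q)
    case (Suc q)
    have "a (Suc q * m + r) \<le> a m + a (q * m + r)"
      using sub[of m "q * m + r"] by (simp add: add.assoc)
    then show ?case using Suc by (simp add: algebra_simps)
  qed simp
  have "(\<lambda>n. a n / real n) \<longlonglongrightarrow> L"
  proof (rule LIMSEQ_I)
    fix e :: real assume e: "e > 0"
    have "\<exists>m\<in>{1..}. a m / real m < L + e / 2"
      using cInf_lessD[of "(\<lambda>n. a n / real n) ` {1..}" "L + e / 2"] e unfolding L_def by auto
    then obtain m where m: "m \<ge> 1" "a m / real m < L + e / 2" by auto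
    define M where "M = (\<Sum>r<m. a r)"
    have M: "a r \<le> M" if "r < m" for r
      unfolding M_def by (rule member_le_sum) (use that nonneg in auto)
    have M0: "M \<ge> 0" unfolding M_def by (rule sum_nonneg) (use nonneg in auto)
    obtain N where N: "real N > 2 * M / e" using reals_Archimedean2 by blast
    have "norm (a n / real n - L) < e" if n: "n \<ge> max 1 N" for n
    proof -
      have "a n \<le> real (n div m) * a m + a (n mod m)" using mult[of "n div m" m "n mod m"] by simp
      also have "\<dots> \<le> real n / real m * a m + M"
      proof (intro add_mono mult_right_mono nonneg M)
        show "real (n div m) \<le> real n / real m" by (rule of_nat_div_le_of_nat)
      qed (use m in auto)
      finally have "a n / real n \<le> a m / real m + M / real n"
        using n by (simp add: field_simps)
      moreover have "M / real n < e / 2"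
      proof -
        have "2 * M < e * real N" using N e by (simp add: field_simps)
        also have "\<dots> \<le> e * real n" using n e by simp
        finally show ?thesis using n by (simp add: field_simps)
      qed
      ultimately have "a n / real n < L + e" using m by linarith
      then show ?thesis using lower[of n] n by simp
    qed
    then show "\<exists>no. \<forall>n\<ge>no. norm (a n / real n - L) < e" by blast
  qed
  then show ?thesis by (rule convergentI)
qed

lemma integral_shift_periodic:
  fixes f :: "real \<Rightarrow> real"
  assumes cont: "continuous_on UNIV f" and per: "\<And>x. f (x + 1) = f x"
  shows "integral {0..1} (\<lambda>x. f (x + c)) = integral {0..1} f"
proof -
  have pern: "f (x + of_int n) = f x" for x n
  proof -
    have nat: "f (x + real k) = f x" for x k
      by (induction k) (simp_all add: per add.assoc[symmetric] add.commute[of 1])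
    show ?thesis using nat[of x "nat n"] nat[of "x + of_int n" "nat (- n)"] by (cases "n \<ge> 0") auto
  qed
  have ci: "continuous_on S f" for S using cont continuous_on_subset by blast
  have shift: "integral {a..b} (\<lambda>x. f (x + d)) = integral {a + d..b + d} f" for a b d
    using integral_shift[OF ci, of a b d] by (simp add: o_def)
  define d where "d = frac c"
  have d: "0 \<le> d" "d \<le> 1" by (simp_all add: d_def frac_lt_1 less_imp_le)
  have "f (x + c) = f (x + d)" for x
    using pern[of "x + d" "floor c"] by (simp add: d_def frac_def)
  then have "integral {0..1} (\<lambda>x. f (x + c)) = integral {d..1 + d} f" using shift[of 0 1 d] by simp
  also have "\<dots> = integral {d..1} f + integral {1..1 + d} f"
    using d by (intro Henstock_Kurzweil_Integration.integral_combine[symmetric] integrable_continuous_real ci) auto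
  also have "integral {1..1 + d} f = integral {0..d} f"
    using shift[of 0 1 d] shift[of 0 d 1] by (simp add: per add.commute)
  also have "integral {d..1} f + integral {0..d} f = integral {0..1} f"
    using d Henstock_Kurzweil_Integration.integral_combine[of 0 d 1 f] by (simp add: integrable_continuous_real ci)
  finally show ?thesis .
qed

section \<open>Operator norms of complex two by two matrices\<close>

abbreviation matrix_norm :: "complex^2^2 \<Rightarrow> real" where
  "matrix_norm M \<equiv> onorm ((*v) M)"

lemma bounded_bilinear_matrix_vector_complex:
  "bounded_bilinear ((*v) :: complex^'n::finite^'m::finite \<Rightarrow> _)"
proof -
  have "bilinear ((*v) :: complex^'n::finite^'m::finite \<Rightarrow> _)"
    unfolding bilinear_def
    by (auto intro!: linearI simp: vec_eq_iff matrix_vector_mult_def sum.distrib algebra_simps scaleR_sum_right)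
  then show ?thesis by (simp add: bilinear_conv_bounded_bilinear)
qed

lemma bounded_linear_matrix_vector_complex:
  "bounded_linear ((*v) (M :: complex^'n::finite^'m::finite))"
  by (rule bounded_bilinear.bounded_linear_right[OF bounded_bilinear_matrix_vector_complex])

lemma matrix_norm_mult: "matrix_norm (M ** N) \<le> matrix_norm M * matrix_norm N"
proof -
  have "(*v) (M ** N) = (*v) M \<circ> (*v) N" by (auto simp: matrix_vector_mul_assoc)
  then show ?thesis
    using onorm_compose[OF bounded_linear_matrix_vector_complex bounded_linear_matrix_vector_complex, of M N] by simp
qed

text \<open>The operator norm is a Lipschitz function of the matrix, because \<open>(*v)\<close> is a bounded bilinear map.\<close>

lemma continuous_on_matrix_norm: "continuous_on S matrix_norm"
proof -
  obtain K where K: "\<And>(M::complex^2^2) w. norm (M *v w) \<le> norm M * norm w * K" "K \<ge> 0"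
    using bounded_bilinear.nonneg_bounded[OF bounded_bilinear_matrix_vector_complex] by blast
  have le: "matrix_norm M - matrix_norm N \<le> K * norm (M - N)" for M N
  proof -
    have "(*v) M = (\<lambda>w. (M - N) *v w + N *v w)"
      by (simp add: fun_eq_iff flip: matrix_vector_mult_add_rdistrib)
    then have "matrix_norm M \<le> matrix_norm (M - N) + matrix_norm N"
      by (metis onorm_triangle[OF bounded_linear_matrix_vector_complex bounded_linear_matrix_vector_complex])
    moreover have "matrix_norm (M - N) \<le> K * norm (M - N)"
      by (rule onorm_le) (use K(1)[of "M - N"] in \<open>simp add: mult.commute mult.left_commute\<close>)
    ultimately show ?thesis by simp
  qed
  have "K-lipschitz_on S matrix_norm"
  proof (rule lipschitz_onI)
    show "dist (matrix_norm M) (matrix_norm N) \<le> K * dist M N" for M N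
      using le[of M N] le[of N M] by (auto simp: dist_norm abs_le_iff norm_minus_commute[of N M])
  qed (rule K(2))
  then show ?thesis by (rule lipschitz_on_continuous_on)
qed

lemma norm_complex_2: "(norm (w :: complex^2))\<^sup>2 = (cmod (w $ 1))\<^sup>2 + (cmod (w $ 2))\<^sup>2"
  by (simp add: norm_vec_def L2_set_def sum_2)

text \<open>The norms of the two columns are at most the operator norm, and the determinant is bounded by
  their squares through the inequality \<open>2 x y \<le> x\<^sup>2 + y\<^sup>2\<close>.\<close>

lemma norm_det_le_matrix_norm_squared: "cmod (det M) \<le> (matrix_norm M)\<^sup>2"
proof -
  have n: "norm (vector [1, 0] :: complex^2) = 1" "norm (vector [0, 1] :: complex^2) = 1"
    by (simp_all add: norm_vec_def L2_set_def sum_2)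
  have c1: "norm (M *v vector [1, 0]) \<le> matrix_norm M" and c2: "norm (M *v vector [0, 1]) \<le> matrix_norm M"
    using onorm[OF bounded_linear_matrix_vector_complex, of M "vector [1, 0]"]
      onorm[OF bounded_linear_matrix_vector_complex, of M "vector [0, 1]"] by (simp_all add: n)
  define a b c d where "a = cmod (M $ 1 $ 1)" and "b = cmod (M $ 1 $ 2)" and "c = cmod (M $ 2 $ 1)" and "d = cmod (M $ 2 $ 2)"
  have sq: "a\<^sup>2 + c\<^sup>2 \<le> (matrix_norm M)\<^sup>2" "b\<^sup>2 + d\<^sup>2 \<le> (matrix_norm M)\<^sup>2"
    using power_mono[OF c1 norm_ge_zero, of 2] power_mono[OF c2 norm_ge_zero, of 2]
    by (simp_all add: norm_complex_2 matrix_vector_mult_def sum_2 a_def b_def c_def d_def)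
  have "cmod (det M) \<le> a * d + b * c"
    using norm_triangle_ineq4[of "M $ 1 $ 1 * M $ 2 $ 2" "M $ 1 $ 2 * M $ 2 $ 1"]
    by (simp add: det_2 a_def b_def c_def d_def norm_mult)
  also have "\<dots> \<le> ((a\<^sup>2 + c\<^sup>2) + (b\<^sup>2 + d\<^sup>2)) / 2"
    using sum_squares_bound[of a d] sum_squares_bound[of b c] by simp
  also have "\<dots> \<le> (matrix_norm M)\<^sup>2" using sq by simp
  finally show ?thesis .
qed

lemma matrix_norm_ge_1:
  assumes "det M = 1"
  shows "matrix_norm M \<ge> 1"
proof (rule ccontr)
  assume "\<not> matrix_norm M \<ge> 1"
  then have "(matrix_norm M)\<^sup>2 < 1"
    using onorm_pos_le[OF bounded_linear_matrix_vector_complex, of M] by (simp add: power_less_one_iff)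
  then show False using norm_det_le_matrix_norm_squared[of M] assms by simp
qed

section \<open>Lyapunov exponents of cocycles with determinant one\<close>

lemma circ_rotation_iter: "((+) \<alpha> ^^ (m + n)) x = ((+) \<alpha> ^^ m) (((+) \<alpha> ^^ n) x)"
  by (simp add: funpow_add)

lemma circ_rotation_iter_circ_of: "((+) (circ_of a) ^^ n) (circ_of t) = circ_of (t + real n * a)"
  by (induction n) (simp_all add: algebra_simps circ_of_add)

lemma cocycle_iter_add:
  "cocycle_iter \<alpha> A (m + n) x = cocycle_iter \<alpha> A m (((+) \<alpha> ^^ n) x) ** cocycle_iter \<alpha> A n x"
  by (induction m) (simp_all add: circ_rotation_iter matrix_mul_assoc matrix_mul_lid)

context
  fixes A :: "circ \<Rightarrow> complex^2^2" and a :: real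
  assumes cont: "continuous_on UNIV (\<lambda>t. A (circ_of t))" and det: "\<And>x. det (A x) = 1"
begin

private abbreviation "An n t \<equiv> cocycle_iter (circ_of a) A n (circ_of t)"

lemma continuous_on_matrix_mult_complex:
  fixes B C :: "real \<Rightarrow> complex^2^2"
  shows "continuous_on S B \<Longrightarrow> continuous_on S C \<Longrightarrow> continuous_on S (\<lambda>t. B t ** C t)"
  unfolding matrix_matrix_mult_def
  by (intro continuous_intros continuous_on_vec_lambda) auto

lemma continuous_cocycle_iter: "continuous_on UNIV (An n)"
proof (induction n)
  case (Suc n)
  have "continuous_on UNIV (\<lambda>t. A (circ_of (t + real n * a)))"
    by (rule continuous_on_compose2[OF cont]) (auto intro!: continuous_intros)
  then show ?case using Suc
    by (simp add: circ_rotation_iter_circ_of continuous_on_matrix_mult_complex)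
qed simp

lemma det_cocycle_iter: "det (cocycle_iter \<alpha> A n x) = 1"
  by (induction n) (simp_all add: det_mul det)

lemma continuous_ln_norm_cocycle_iter: "continuous_on UNIV (\<lambda>t. ln (matrix_norm (An n t)))"
proof -
  have "continuous_on UNIV (\<lambda>t. matrix_norm (An n t))"
    by (rule continuous_on_compose2[OF continuous_on_matrix_norm continuous_cocycle_iter]) auto
  then show ?thesis
    using matrix_norm_ge_1[OF det_cocycle_iter]
    by (intro continuous_on_ln) (auto, metis not_one_le_zero)
qed

text \<open>The logarithmic means are subadditive: the norm is submultiplicative, and the rotation preserves the
  integral over the circle. They are nonnegative because the determinant is one.\<close>

lemma lyapunov_exponent_tendsto:
  "(\<lambda>n. integral {0..1} (\<lambda>t. ln (matrix_norm (An n t))) / real n)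
     \<longlonglongrightarrow> lyapunov_exponent (circ_of a) A"
proof -
  define I where "I n = integral {0..1} (\<lambda>t. ln (matrix_norm (An n t)))" for n
  have int: "(\<lambda>t. ln (matrix_norm (An n (t + c)))) integrable_on {0..1}" for n c
    by (intro integrable_continuous_real continuous_on_compose2[OF continuous_ln_norm_cocycle_iter])
       (auto intro!: continuous_intros)
  note ge1 = matrix_norm_ge_1[OF det_cocycle_iter]
  have "I (m + n) \<le> I m + I n" for m n
  proof -
    have "ln (matrix_norm (An (m + n) t)) \<le> ln (matrix_norm (An m (t + real n * a))) + ln (matrix_norm (An n t))" for t
    proof -
      have "matrix_norm (An (m + n) t) \<le> matrix_norm (An m (t + real n * a)) * matrix_norm (An n t)"
        unfolding cocycle_iter_add circ_rotation_iter_circ_of by (rule matrix_norm_mult)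
      moreover have pos: "matrix_norm (cocycle_iter (circ_of a) A k x) > 0" for k x
        using ge1[of "circ_of a" k x] by linarith
      ultimately have "ln (matrix_norm (An (m + n) t)) \<le> ln (matrix_norm (An m (t + real n * a)) * matrix_norm (An n t))"
        by (subst ln_le_cancel_iff) auto
      then show ?thesis using pos by (simp only: ln_mult_pos)
    qed
    then have "I (m + n) \<le> integral {0..1} (\<lambda>t. ln (matrix_norm (An m (t + real n * a))) + ln (matrix_norm (An n t)))"
      unfolding I_def using int[of _ 0] int by (intro integral_le integrable_add) auto
    also have "\<dots> = integral {0..1} (\<lambda>t. ln (matrix_norm (An m (t + real n * a)))) + I n"
      unfolding I_def using int[of _ 0] int by (intro integral_add) auto
    also have "integral {0..1} (\<lambda>t. ln (matrix_norm (An m (t + real n * a)))) = I m"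
      unfolding I_def by (rule integral_shift_periodic[OF continuous_ln_norm_cocycle_iter]) simp
    finally show ?thesis .
  qed
  moreover have "I n \<ge> 0" for n
    unfolding I_def using int[of n 0] ge1 by (intro integral_nonneg) auto
  ultimately have "convergent (\<lambda>n. I n / real n)" by (rule subadditive_convergent)
  then show ?thesis
    unfolding lyapunov_exponent_def I_def by (simp add: convergent_LIMSEQ_iff)
qed

lemma lyapunov_exponent_nonneg: "lyapunov_exponent (circ_of a) A \<ge> 0"
proof (rule LIMSEQ_le_const[OF lyapunov_exponent_tendsto])
  have "integral {0..1} (\<lambda>t. ln (matrix_norm (An n t))) \<ge> 0" for n
    using matrix_norm_ge_1[OF det_cocycle_iter]
    by (intro integral_nonneg integrable_continuous_real continuous_on_subset[OF continuous_ln_norm_cocycle_iter]) auto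
  then show "\<exists>N. \<forall>n\<ge>N. 0 \<le> integral {0..1} (\<lambda>t. ln (matrix_norm (An n t))) / real n" by simp
qed

lemma lyapunov_exponent_geI:
  assumes "\<And>n. n > 0 \<Longrightarrow> integral {0..1} (\<lambda>t. ln (matrix_norm (An n t))) \<ge> real n * b - c"
  shows "lyapunov_exponent (circ_of a) A \<ge> b"
proof (rule LIMSEQ_le[OF _ lyapunov_exponent_tendsto])
  show "(\<lambda>n. b - c / real n) \<longlonglongrightarrow> b"
    using tendsto_diff[OF tendsto_const lim_const_over_n[of c], of b] by simp
  show "\<exists>N. \<forall>n\<ge>N. b - c / real n \<le> integral {0..1} (\<lambda>t. ln (matrix_norm (An n t))) / real n"
  proof (intro exI[of _ 1] allI impI)
    fix n :: nat assume "n \<ge> 1"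
    then show "b - c / real n \<le> integral {0..1} (\<lambda>t. ln (matrix_norm (An n t))) / real n"
      using divide_right_mono[OF assms[of n], of "real n"] by (simp add: diff_divide_distrib)
  qed
qed

lemma lyapunov_exponent_eq_0I:
  assumes "\<And>n t. matrix_norm (An n t) \<le> c"
  shows "lyapunov_exponent (circ_of a) A = 0"
proof (rule antisym[OF _ lyapunov_exponent_nonneg])
  show "lyapunov_exponent (circ_of a) A \<le> 0"
  proof (rule LIMSEQ_le[OF lyapunov_exponent_tendsto lim_const_over_n[of "ln c"]])
    have "integral {0..1} (\<lambda>t. ln (matrix_norm (An n t))) \<le> ln c" for n
    proof -
      have "ln (matrix_norm (An n t)) \<le> ln c" for t
        using assms[of n t] matrix_norm_ge_1[OF det_cocycle_iter, of "circ_of a" n "circ_of t"] by simp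
      then have "integral {0..1} (\<lambda>t. ln (matrix_norm (An n t))) \<le> integral {0..1} (\<lambda>t::real. ln c)"
        by (intro integral_le integrable_continuous_real continuous_on_subset[OF continuous_ln_norm_cocycle_iter]) auto
      then show ?thesis by simp
    qed
    then show "\<exists>N. \<forall>n\<ge>N. integral {0..1} (\<lambda>t. ln (matrix_norm (An n t))) / real n \<le> ln c / real n"
      by (auto simp: divide_right_mono)
  qed
qed

end

section \<open>The complexified Szego cocycle\<close>

lemma vector_2_eq: "(vector [x, y] :: 'a::zero ^ 2) = (\<chi> i. if i = 1 then x else y)"
  by (simp add: vec_eq_iff forall_2)

lemma norm_csqrt_unit: "cmod E = 1 \<Longrightarrow> cmod (csqrt E) = 1"
  by simp

lemma det_szego_cocycle:
  assumes E: "cmod E = 1" and l: "0 < l" "l < 1" and v: "cmod (v x) = 1"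
  shows "det (szego_cocycle E l v x) = 1"
proof -
  have l2: "1 - l\<^sup>2 > 0" using l by (simp add: power_less_one_iff)
  have nz: "csqrt E \<noteq> 0" using norm_csqrt_unit[OF E] by auto
  have vv: "v x * cnj (v x) = 1" using complex_norm_square[of "v x"] v by simp
  define c where "c = (1 - l\<^sup>2) powr (- 1 / 2)"
  have "c * c = (1 - l\<^sup>2) powr (- 1)" unfolding c_def by (simp flip: powr_add)
  then have c: "c * c * (1 - l\<^sup>2) = 1" using l2 by (simp add: powr_minus)
  have "det (szego_cocycle E l v x) = of_real (c * c) * (1 - of_real (l\<^sup>2) * (v x * cnj (v x)))"
    unfolding szego_cocycle_def det_2 c_def[symmetric]
    using nz by (simp add: scaleR_conv_of_real[where 'a=complex] field_simps power2_eq_square)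
  also have "\<dots> = of_real (c * c * (1 - l\<^sup>2))" by (simp add: vv)
  finally show ?thesis using c by simp
qed

text \<open>Up to normalisation this is the orbit under the complexified Szego cocycle of the vector
  \<open>(1, - V(z - a))\<close>, which is the column direction of the rank one matrix at the preceding point
  \<open>z - a\<close>. Here \<open>cnj v\<close> has been replaced by \<open>1 / V\<close>, which agrees with it on the real line and is
  holomorphic.\<close>

primrec szego_orbit :: "(complex \<Rightarrow> complex) \<Rightarrow> complex \<Rightarrow> real \<Rightarrow> real \<Rightarrow> nat \<Rightarrow> complex \<Rightarrow> complex \<times> complex" where
  "szego_orbit V s l a 0 z = (1, - V (z - of_real a))"
| "szego_orbit V s l a (Suc n) z =
    (let w = szego_orbit V s l a n z; u = V (z + of_real (real n * a)) in
      (s * fst w - of_real l * snd w / (u * s), - of_real l * u * s * fst w + snd w / s))"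

text \<open>Nonvanishing of \<open>V\<close> is what allows \<open>cnj v\<close> to be continued holomorphically, as \<open>1 / V\<close>,
  so that the whole cocycle extends holomorphically to the strip.\<close>

locale analytic_szego =
  fixes v :: "circ \<Rightarrow> complex" and V :: "complex \<Rightarrow> complex" and \<rho> :: real
  assumes \<rho>_pos: "\<rho> > 0"
    and hol: "V holomorphic_on strip \<rho>"
    and nz: "z \<in> strip \<rho> \<Longrightarrow> V z \<noteq> 0"
    and periodic: "z \<in> strip \<rho> \<Longrightarrow> V (z + 1) = V z"
    and on_real: "V (of_real t) = v (circ_of t)"
    and unit: "cmod (v x) = 1"
begin

lemma continuous_v: "continuous_on UNIV (\<lambda>t. v (circ_of t))"
proof -
  have "continuous_on UNIV (\<lambda>t. V (of_real t))"
    by (rule continuous_on_compose2[OF holomorphic_on_imp_continuous_on[OF hol]])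
      (use \<rho>_pos in \<open>auto intro!: continuous_intros\<close>)
  then show ?thesis by (simp add: on_real)
qed

lemma continuous_szego_cocycle: "cmod E = 1 \<Longrightarrow> continuous_on UNIV (\<lambda>t. szego_cocycle E l v (circ_of t))"
proof -
  have vec: "continuous_on UNIV (\<lambda>t. vector [f t, g t] :: 'b^2)"
    if "continuous_on UNIV f" "continuous_on UNIV g" for f g :: "real \<Rightarrow> 'b::real_normed_vector"
    unfolding vector_2_eq
  proof (rule continuous_on_vec_lambda)
    show "continuous_on UNIV (\<lambda>t. if i = 1 then f t else g t)" for i :: 2
      using that by (cases "i = 1") auto
  qed
  assume "cmod E = 1"
  then have "csqrt E \<noteq> 0" using norm_csqrt_unit by fastforce
  then show ?thesis
    unfolding szego_cocycle_def by (intro continuous_intros vec continuous_v) auto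
qed

lemma periodic_int: "z \<in> strip \<rho> \<Longrightarrow> V (z + of_int n) = V z"
proof -
  have nat: "V (z + of_nat k) = V z" if "z \<in> strip \<rho>" for z k
  proof (induction k)
    case (Suc k)
    then show ?case using periodic[of "z + of_nat k"] that by (simp add: algebra_simps)
  qed simp
  assume "z \<in> strip \<rho>"
  then show ?thesis using nat[of z "nat n"] nat[of "z + of_int n" "nat (- n)"] by (cases "n \<ge> 0") auto
qed

lemma norm_bounds:
  assumes "y < \<rho>"
  obtains K where "K \<ge> 1" "\<And>z. \<bar>Im z\<bar> \<le> y \<Longrightarrow> cmod (V z) \<le> K" "\<And>z. \<bar>Im z\<bar> \<le> y \<Longrightarrow> 1 / K \<le> cmod (V z)"
proof -
  define C where "C = cbox (Complex 0 (- y)) (Complex 1 y)"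
  have sub: "C \<subseteq> strip \<rho>" using assms by (auto simp: C_def in_cbox_complex_iff)
  have cV: "continuous_on C V"
    by (rule continuous_on_subset[OF holomorphic_on_imp_continuous_on[OF hol] sub])
  have "continuous_on C (\<lambda>z. inverse (V z))"
    by (intro continuous_on_inverse cV) (use nz sub in auto)
  with cV have "bounded (V ` C)" "bounded ((\<lambda>z. inverse (V z)) ` C)"
    by (auto intro!: compact_imp_bounded compact_continuous_image simp: C_def)
  then obtain K1 K2 where K: "\<And>z. z \<in> C \<Longrightarrow> cmod (V z) \<le> K1" "\<And>z. z \<in> C \<Longrightarrow> cmod (inverse (V z)) \<le> K2"
    unfolding bounded_iff by (metis imageI)
  define K where "K = max 1 (max K1 K2)"
  have red: "\<exists>w\<in>C. V w = V z" if "\<bar>Im z\<bar> \<le> y" for z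
  proof
    show "V (z + of_int (- floor (Re z))) = V z" by (rule periodic_int) (use that assms in auto)
    have "0 \<le> Re z - of_int (floor (Re z))" "Re z - of_int (floor (Re z)) \<le> 1" by linarith+
    then show "z + of_int (- floor (Re z)) \<in> C" using that by (auto simp: C_def in_cbox_complex_iff)
  qed
  show thesis
  proof
    show "K \<ge> 1" by (simp add: K_def)
    show "cmod (V z) \<le> K" if z: "\<bar>Im z\<bar> \<le> y" for z
    proof -
      obtain w where "w \<in> C" "V w = V z" using red[OF z] by blast
      then show ?thesis using K(1)[of w] by (simp add: K_def)
    qed
    show "1 / K \<le> cmod (V z)" if z: "\<bar>Im z\<bar> \<le> y" for z
    proof -
      have "1 / cmod (V z) \<le> K"
      proof -
        obtain w where "w \<in> C" "V w = V z" using red[OF z] by blast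
        then show ?thesis using K(2)[of w] by (simp add: K_def norm_divide inverse_eq_divide le_max_iff_disj)
      qed
      moreover have "cmod (V z) > 0" using nz[of z] z assms by simp
      ultimately show ?thesis using \<open>K \<ge> 1\<close> by (simp add: field_simps)
    qed
  qed
qed

lemma holomorphic_shift: "(\<lambda>z. V (z + of_real c)) holomorphic_on strip \<rho>"
  by (rule holomorphic_on_compose_gen[where f="\<lambda>z. z + of_real c", OF _ hol, unfolded o_def])
    (auto intro!: holomorphic_intros)

context
  fixes E s :: complex and l a :: real
  assumes s2: "s\<^sup>2 = E" and s1: "cmod s = 1" and l: "0 < l" "l < 1"
begin

private abbreviation "orb \<equiv> szego_orbit V s l a"

lemma s_nz: "s \<noteq> 0" using s1 by auto

lemma holomorphic_szego_orbit:
  "(\<lambda>z. fst (orb n z)) holomorphic_on strip \<rho> \<and> (\<lambda>z. snd (orb n z)) holomorphic_on strip \<rho>"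
proof (induction n)
  case 0
  show ?case using holomorphic_shift[of "- a"] by (auto intro!: holomorphic_intros)
next
  case (Suc n)
  have "V (z + of_real (real n * a)) \<noteq> 0" if "z \<in> strip \<rho>" for z
    by (rule nz) (use that in simp)
  then show ?case
    using Suc holomorphic_shift[of "real n * a"] s_nz
    by (auto simp: Let_def intro!: holomorphic_intros)
qed

lemma periodic_szego_orbit: "z \<in> strip \<rho> \<Longrightarrow> orb n (z + 1) = orb n z"
proof (induction n)
  case 0
  then show ?case using periodic[of "z - of_real a"] by (simp add: algebra_simps)
next
  case (Suc n)
  then show ?case using periodic[of "z + of_real (real n * a)"] by (simp add: algebra_simps Let_def)
qed

text \<open>The unnormalised matrices have determinant \<open>1 - l\<^sup>2\<close>, so they are invertible and never annihilate the
  orbit.\<close>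

lemma szego_orbit_nonzero: "z \<in> strip \<rho> \<Longrightarrow> fst (orb n z) \<noteq> 0 \<or> snd (orb n z) \<noteq> 0"
proof (induction n)
  case (Suc n)
  define u x y where "u = V (z + of_real (real n * a))" and "x = fst (orb n z)" and "y = snd (orb n z)"
  have u: "u \<noteq> 0" unfolding u_def by (rule nz) (use Suc.prems in simp)
  show ?case
  proof (rule ccontr)
    assume "\<not> ?thesis"
    then have 1: "s * x - of_real l * y / (u * s) = 0" and 2: "- of_real l * u * s * x + y / s = 0"
      by (simp_all add: Let_def u_def x_def y_def)
    from 2 have y: "y = of_real l * u * s * s * x" using s_nz by (simp add: field_simps)
    from 1 have "(1 - (of_real l)\<^sup>2) * x = 0" using s_nz u by (simp add: y field_simps power2_eq_square)
    moreover have "(of_real l)\<^sup>2 \<noteq> (1 :: complex)"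
      using l by (metis abs_square_eq_1 abs_of_pos less_irrefl of_real_eq_1_iff of_real_power)
    ultimately have "x = 0" by simp
    then show False using y Suc by (simp add: x_def y_def)
  qed
qed simp

lemma szego_orbit_upper:
  assumes K: "K \<ge> 1" "\<And>z. \<bar>Im z\<bar> \<le> y \<Longrightarrow> cmod (V z) \<le> K" "\<And>z. \<bar>Im z\<bar> \<le> y \<Longrightarrow> 1 / K \<le> cmod (V z)"
    and z: "\<bar>Im z\<bar> \<le> y"
  shows "cmod (fst (orb n z)) + cmod (snd (orb n z)) \<le> (1 + K) ^ (n + 1)"
proof (induction n)
  case 0
  show ?case using K(2)[of "z - of_real a"] z by simp
next
  case (Suc n)
  define u p q where "u = V (z + of_real (real n * a))" and "p = fst (orb n z)" and "q = snd (orb n z)"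
  have u: "cmod u \<le> K" "1 / K \<le> cmod u" unfolding u_def using K(2,3) z by auto
  have u0: "cmod u > 0" using u(2) K(1) by (smt (verit) divide_pos_pos)
  have iu: "1 / cmod u \<le> K" using u(2) u0 K(1) by (simp add: field_simps)
  have "cmod (s * p - of_real l * q / (u * s)) \<le> cmod p + l * cmod q * (1 / cmod u)"
    using norm_triangle_ineq4[of "s * p" "of_real l * q / (u * s)"] l s1 by (simp add: norm_mult norm_divide)
  also have "\<dots> \<le> cmod p + 1 * cmod q * K"
    by (intro add_mono mult_mono) (use l iu in auto)
  finally have 1: "cmod (s * p - of_real l * q / (u * s)) \<le> cmod p + cmod q * K" by simp
  have "cmod (- of_real l * u * s * p + q / s) \<le> l * cmod u * cmod p + cmod q"
    using norm_triangle_ineq[of "- of_real l * u * s * p" "q / s"] l s1 by (simp add: norm_mult norm_divide)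
  also have "\<dots> \<le> 1 * K * cmod p + cmod q"
    by (intro add_mono mult_mono) (use l u K in auto)
  finally have 2: "cmod (- of_real l * u * s * p + q / s) \<le> K * cmod p + cmod q" by simp
  have "cmod (fst (orb (Suc n) z)) + cmod (snd (orb (Suc n) z)) \<le> (1 + K) * (cmod p + cmod q)"
    using 1 2 by (simp add: Let_def u_def p_def q_def algebra_simps)
  also have "\<dots> \<le> (1 + K) * (1 + K) ^ (n + 1)"
    using Suc K(1) by (intro mult_left_mono) (auto simp: p_def q_def)
  finally show ?case by simp
qed

text \<open>With \<open>h = d / (2 K)\<close>, the vectors \<open>(p, q)\<close> with \<open>\<bar>q + V p\<bar> \<le> h \<bar>p\<bar>\<close> form a cone around the column
  direction \<open>(1, - V)\<close> of the rank one matrix. At \<open>l = 1\<close> such a vector is sent to \<open>t (1, - u)\<close>, where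
  \<open>u\<close> is the value of \<open>V\<close> at the new point, and \<open>\<bar>t\<bar> \<ge> \<bar>p\<bar> d / 2\<close> by the choice of \<open>h\<close>. The hypotheses
  on \<open>l\<close> say that the perturbation of size \<open>1 - l\<close> takes away at most half of this expansion and
  keeps the image inside the cone over the new point.\<close>

lemma szego_orbit_lower:
  assumes K: "K \<ge> 1" "\<And>z. Im z = y \<Longrightarrow> cmod (V z) \<le> K" "\<And>z. Im z = y \<Longrightarrow> 1 / K \<le> cmod (V z)"
    and d: "d > 0" "\<And>z. Im z = y \<Longrightarrow> d \<le> cmod (E + V (z - of_real a) / V z)"
    and l1: "d / 4 \<le> l * d / 2 - (1 - l)" and l2: "(1 - l) * (2 * K + d / (2 * K)) \<le> d / (2 * K) * (d / 4)"
    and z: "Im z = y"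
  shows "(d / 4) ^ n \<le> cmod (fst (orb n z)) \<and>
    cmod (snd (orb n z) + V (z + of_real ((real n - 1) * a)) * fst (orb n z)) \<le> d / (2 * K) * cmod (fst (orb n z))"
proof (induction n)
  case 0
  show ?case using d K by simp
next
  case (Suc n)
  define u p q where "u = V (z + of_real (real n * a))" and "p = fst (orb n z)" and "q = snd (orb n z)"
  define b where "b = V (z + of_real ((real n - 1) * a))"
  define h where "h = d / (2 * K)"
  have h: "h > 0" "h * K = d / 2" using d K by (simp_all add: h_def)
  have u: "cmod u \<le> K" "1 / K \<le> cmod u" "cmod b \<le> K" unfolding u_def b_def using K(2,3) z by auto
  have u0: "cmod u > 0" using u(2) K(1) by (smt (verit) divide_pos_pos)
  have iu: "1 / cmod u \<le> K" using u(2) u0 K(1) by (simp add: field_simps)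
  have IH: "(d / 4) ^ n \<le> cmod p" "cmod (q + b * p) \<le> h * cmod p"
    using Suc by (simp_all add: p_def q_def b_def h_def)
  have Db: "d \<le> cmod (E + b / u)"
    using d(2)[of "z + of_real (real n * a)"] z by (simp add: b_def u_def algebra_simps)
  \<comment> \<open>The scalar by which the rank one matrix multiplies its column direction.\<close>
  define t where "t = s * p - q / (u * s)"
  have "t = (p * (E + b / u) - (q + b * p) / u) / s"
    using s_nz u0 by (auto simp: t_def s2[symmetric] field_simps power2_eq_square)
  then have "cmod t = cmod (p * (E + b / u) - (q + b * p) / u)" by (simp add: norm_divide s1)
  also have "\<dots> \<ge> cmod p * cmod (E + b / u) - cmod (q + b * p) * (1 / cmod u)"
    using norm_triangle_ineq2[of "p * (E + b / u)" "(q + b * p) / u"] by (simp add: norm_mult norm_divide)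
  also have "cmod p * cmod (E + b / u) - cmod (q + b * p) * (1 / cmod u) \<ge> cmod p * d - (h * cmod p) * K"
    by (intro diff_mono mult_mono Db IH iu) (use h K(1) in auto)
  finally have "cmod t \<ge> cmod p * d - (h * K) * cmod p" by (simp add: mult.assoc mult.commute[of K])
  then have t: "cmod t \<ge> cmod p * d / 2" unfolding h(2) by (simp add: mult.commute)
  define p' q' where "p' = fst (orb (Suc n) z)" and "q' = snd (orb (Suc n) z)"
  have p': "p' = of_real l * t + of_real (1 - l) * (s * p)"
    by (simp add: p'_def Let_def t_def p_def q_def u_def algebra_simps)
  have q': "q' + u * p' = of_real (1 - l) * (u * s * p + q / s)"
  proof -
    have orb_Suc: "p' = s * p - of_real l * q / (u * s)" "q' = - of_real l * u * s * p + q / s"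
      by (simp_all add: p'_def q'_def Let_def p_def q_def u_def)
    show ?thesis using u0 s_nz unfolding orb_Suc by (simp add: field_simps)
  qed
  have "cmod p' \<ge> l * cmod t - (1 - l) * cmod p"
    unfolding p' using norm_diff_ineq[of "of_real l * t" "of_real (1 - l) * (s * p)"] l s1
    by (simp add: norm_mult del: of_real_diff)
  moreover have "l * cmod t \<ge> l * (cmod p * d / 2)" using t l by (intro mult_left_mono) auto
  moreover have "cmod p * (d / 4) \<le> cmod p * (l * d / 2 - (1 - l))" by (intro mult_left_mono l1) auto
  ultimately have pp: "cmod p' \<ge> cmod p * (d / 4)" by (simp add: algebra_simps)
  have "cmod q \<le> cmod (q + b * p) + cmod (b * p)" using norm_triangle_ineq4[of "q + b * p" "b * p"] by simp
  also have "\<dots> \<le> h * cmod p + K * cmod p"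
    unfolding norm_mult by (intro add_mono IH mult_right_mono u) auto
  finally have qq: "cmod q \<le> h * cmod p + K * cmod p" .
  have "cmod (q' + u * p') = (1 - l) * cmod (u * s * p + q / s)"
    unfolding q' norm_mult using l by (simp del: of_real_diff)
  also have "\<dots> \<le> (1 - l) * (K * cmod p + (h * cmod p + K * cmod p))"
  proof (rule mult_left_mono)
    have "cmod (u * s * p + q / s) \<le> cmod u * cmod p + cmod q"
      using norm_triangle_ineq[of "u * s * p" "q / s"] s1 by (simp add: norm_mult norm_divide)
    also have "\<dots> \<le> K * cmod p + (h * cmod p + K * cmod p)"
      by (intro add_mono qq mult_right_mono u) auto
    finally show "cmod (u * s * p + q / s) \<le> \<dots>" .
  qed (use l in simp)
  also have "\<dots> = ((1 - l) * (2 * K + h)) * cmod p" by (simp add: algebra_simps)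
  also have "\<dots> \<le> h * (d / 4) * cmod p" using l2 by (intro mult_right_mono) (auto simp: h_def)
  also have "\<dots> \<le> h * cmod p'" using pp h by (simp add: mult.assoc mult.commute[of d])
  finally have "cmod (q' + u * p') \<le> h * cmod p'" .
  moreover have "(d / 4) ^ Suc n \<le> cmod p'"
    using pp mult_right_mono[OF IH(1), of "d / 4"] d(1) unfolding power_Suc2 by linarith
  ultimately show ?case by (simp add: p'_def q'_def u_def h_def)
qed

text \<open>On the real line \<open>1 / V = cnj v\<close>, so there the complexified orbit is the orbit of the true cocycle.\<close>

lemma cocycle_iter_szego_orbit:
  assumes "s = csqrt E"
  shows "cocycle_iter (circ_of a) (szego_cocycle E l v) n (circ_of t) *v vector [1, - V (of_real t - of_real a)]
    = ((1 - l\<^sup>2) powr (- 1 / 2)) ^ n *\<^sub>R vector [fst (orb n (of_real t)), snd (orb n (of_real t))]"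
proof (induction n)
  case 0
  show ?case by simp
next
  case (Suc n)
  define c where "c = (1 - l\<^sup>2) powr (- 1 / 2)"
  define x where "x = t + real n * a"
  have V: "V (of_real t + of_real (real n * a)) = v (circ_of x)" using on_real[of x] by (simp add: x_def)
  have cnj: "cnj (v (circ_of x)) = 1 / v (circ_of x)"
    using unit[of "circ_of x"] complex_norm_square[of "v (circ_of x)"]
    by (metis mult_zero_left nonzero_eq_divide_eq norm_zero of_real_1 one_power2 zero_neq_one mult.commute)
  define p q u where "p = fst (orb n (of_real t))" and "q = snd (orb n (of_real t))" and "u = v (circ_of x)"
  have orb_Suc: "orb (Suc n) (of_real t) = (s * p - of_real l * q / (u * s), - of_real l * u * s * p + q / s)"
    using V by (simp add: Let_def p_def q_def u_def)
  have "cocycle_iter (circ_of a) (szego_cocycle E l v) (Suc n) (circ_of t) *v vector [1, - V (of_real t - of_real a)]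
     = szego_cocycle E l v (circ_of x) *v (c ^ n *\<^sub>R vector [p, q])"
    unfolding p_def q_def cocycle_iter.simps matrix_vector_mul_assoc[symmetric] Suc c_def x_def circ_rotation_iter_circ_of ..
  also have "\<dots> = c ^ Suc n *\<^sub>R vector [fst (orb (Suc n) (of_real t)), snd (orb (Suc n) (of_real t))]"
    unfolding szego_cocycle_def c_def[symmetric] assms[symmetric] orb_Suc u_def[symmetric]
    by (simp add: vec_eq_iff forall_2 matrix_vector_mult_def sum_2 cnj[folded u_def] scaleR_conv_of_real[where 'a=complex]
        algebra_simps)
  finally show ?case by (simp add: c_def)
qed

end

text \<open>Let \<open>\<Phi> n y\<close> be the mean of \<open>ln\<close> of the squared norm of the \<open>n\<close>-th orbit vector over the line
  \<open>Im z = y\<close>. Cone expansion bounds \<open>\<Phi> n y1\<close> from below, the crude bound \<open>(1 + K) ^ (n + 1)\<close> controls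
  \<open>\<Phi> n y2\<close> from above, and convexity at \<open>y1 = (1 - r) 0 + r y2\<close> turns these into a lower bound for
  \<open>\<Phi> n 0\<close>. The latter is at most twice the integral of \<open>ln\<close> of the norm of the cocycle iterate, up
  to the normalising factor and a constant from the length of the initial vector.\<close>

lemma lyapunov_exponent_lower_bound:
  assumes E: "cmod E = 1" and l: "0 < l" "l < 1"
    and y: "0 < y1" "y1 < y2" "y2 < \<rho>"
    and K: "K \<ge> 1" "\<And>z. \<bar>Im z\<bar> \<le> y2 \<Longrightarrow> cmod (V z) \<le> K" "\<And>z. \<bar>Im z\<bar> \<le> y2 \<Longrightarrow> 1 / K \<le> cmod (V z)"
    and d: "d > 0" "\<And>z. Im z = y1 \<Longrightarrow> d \<le> cmod (E + V (z - of_real a) / V z)"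
    and l1: "d / 4 \<le> l * d / 2 - (1 - l)" and l2: "(1 - l) * (2 * K + d / (2 * K)) \<le> d / (2 * K) * (d / 4)"
  shows "lyapunov_exponent (circ_of a) (szego_cocycle E l v)
    \<ge> - (1 / 2) * ln (1 - l\<^sup>2) + (ln (d / 4) - y1 / y2 * ln (1 + K)) / (1 - y1 / y2)"
proof -
  define s where "s = csqrt E"
  have s: "s\<^sup>2 = E" "cmod s = 1" by (simp_all add: s_def E)
  define orb where "orb = szego_orbit V s l a"
  define N where "N n z = (cmod (fst (orb n z)))\<^sup>2 + (cmod (snd (orb n z)))\<^sup>2" for n z
  define \<Phi> where "\<Phi> n y = integral {0..1} (\<lambda>x. ln (N n (Complex x y)))" for n y
  define r where "r = y1 / y2"
  have r: "0 < r" "r < 1" using y by (simp_all add: r_def)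
  define B where "B = (ln (d / 4) - r * ln (1 + K)) / (1 - r)"
  define A where "A = szego_cocycle E l v"
  have contA: "continuous_on UNIV (\<lambda>t. A (circ_of t))" and detA: "\<And>x. det (A x) = 1"
    unfolding A_def by (rule continuous_szego_cocycle[OF E], rule det_szego_cocycle[OF E l unit])
  define An where "An n t = cocycle_iter (circ_of a) A n (circ_of t)" for n t
  have hols: "(\<lambda>z. fst (orb n z)) holomorphic_on strip \<rho>" "(\<lambda>z. snd (orb n z)) holomorphic_on strip \<rho>" for n
    using holomorphic_szego_orbit[OF s l, of a n] unfolding orb_def by auto
  have Npos: "N n z > 0" if "z \<in> strip \<rho>" for n z
    using szego_orbit_nonzero[OF s l that, of a n] unfolding N_def orb_def
    by (metis add_pos_nonneg add_nonneg_pos zero_le_power2 zero_less_norm_iff zero_less_power)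
  have convex: "convex_on {-\<rho><..<\<rho>} (\<Phi> n)" for n
    unfolding \<Phi>_def N_def
  proof (rule convex_on_integral_ln_norm[OF hols])
    show "fst (orb n (z + 1)) = fst (orb n z)" "snd (orb n (z + 1)) = snd (orb n z)" if "z \<in> strip \<rho>" for z
      using periodic_szego_orbit[OF s l that, of a n] by (simp_all add: orb_def)
    show "fst (orb n z) \<noteq> 0 \<or> snd (orb n z) \<noteq> 0" if "z \<in> strip \<rho>" for z
      using szego_orbit_nonzero[OF s l that, of a n] by (simp add: orb_def)
  qed
  have int: "(\<lambda>x. ln (N n (Complex x y))) integrable_on {0..1}" if "\<bar>y\<bar> < \<rho>" for n y
  proof (rule integrable_continuous_real)
    have "continuous_on (strip \<rho>) (\<lambda>z. N n z)"
      unfolding N_def by (intro continuous_intros holomorphic_on_imp_continuous_on hols)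
    moreover have "N n z \<noteq> 0" if "z \<in> strip \<rho>" for z
      using Npos[OF that, of n] by simp
    ultimately have "continuous_on (strip \<rho>) (\<lambda>z. ln (N n z))"
      by (intro continuous_on_ln) blast+
    then show "continuous_on {0..1} (\<lambda>x. ln (N n (Complex x y)))"
      unfolding Complex_eq by (rule continuous_on_compose2) (use that in \<open>auto intro!: continuous_intros\<close>)
  qed
  have low: "\<Phi> n y1 \<ge> 2 * real n * ln (d / 4)" for n
  proof -
    have "2 * real n * ln (d / 4) \<le> ln (N n (Complex x y1))" for x
    proof -
      have "(d / 4) ^ n \<le> cmod (fst (orb n (Complex x y1)))"
        unfolding orb_def
        by (rule szego_orbit_lower[OF s l K(1) _ _ d l1 l2, THEN conjunct1]) (use y K in auto)
      then have "((d / 4) ^ n)\<^sup>2 \<le> (cmod (fst (orb n (Complex x y1))))\<^sup>2"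
        using d by (intro power_mono) auto
      then have "((d / 4) ^ n)\<^sup>2 \<le> N n (Complex x y1)" unfolding N_def by (simp add: add_increasing2)
      then have "ln (((d / 4) ^ n)\<^sup>2) \<le> ln (N n (Complex x y1))" using d by (intro ln_mono) auto
      then show ?thesis using d by (simp add: ln_realpow flip: power_mult)
    qed
    then have "integral {0..1} (\<lambda>x::real. 2 * real n * ln (d / 4)) \<le> \<Phi> n y1"
      unfolding \<Phi>_def using y by (intro integral_le int) auto
    then show ?thesis by simp
  qed
  have up: "\<Phi> n y2 \<le> 2 * (real n + 1) * ln (1 + K)" for n
  proof -
    have "ln (N n (Complex x y2)) \<le> 2 * (real n + 1) * ln (1 + K)" for x
    proof -
      have "N n (Complex x y2) \<le> (cmod (fst (orb n (Complex x y2))) + cmod (snd (orb n (Complex x y2))))\<^sup>2"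
        by (simp add: N_def power2_sum)
      also have "\<dots> \<le> ((1 + K) ^ (n + 1))\<^sup>2"
        unfolding orb_def
        by (intro power_mono szego_orbit_upper[OF s l K]) (use y in auto)
      finally have "ln (N n (Complex x y2)) \<le> ln (((1 + K) ^ (n + 1))\<^sup>2)"
        using Npos[of "Complex x y2" n] y by (intro ln_mono) auto
      then show ?thesis using K(1) by (simp add: ln_realpow algebra_simps flip: power_mult del: power_Suc)
    qed
    then have "\<Phi> n y2 \<le> integral {0..1} (\<lambda>x::real. 2 * (real n + 1) * ln (1 + K))"
      unfolding \<Phi>_def using y by (intro integral_le int) auto
    then show ?thesis by simp
  qed
  have three: "\<Phi> n y1 \<le> (1 - r) * \<Phi> n 0 + r * \<Phi> n y2" for n
    using convex_onD[OF convex, of r 0 y2 n] r y by (simp add: r_def)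
  have zero: "\<Phi> n 0 \<le> 2 * integral {0..1} (\<lambda>t. ln (matrix_norm (An n t))) + real n * ln (1 - l\<^sup>2) + ln 2" for n
  proof -
    have l2: "1 - l\<^sup>2 > 0" using l by (simp add: power_less_one_iff)
    have pw: "ln (N n (Complex t 0)) \<le> 2 * ln (matrix_norm (An n t)) + (real n * ln (1 - l\<^sup>2) + ln 2)" for t
    proof -
      define w :: "complex^2" where "w = vector [1, - V (of_real t - of_real a)]"
      \<comment> \<open>The initial vector has length \<open>\<surd>2\<close> on the real line, which costs the additive constant \<open>ln 2\<close>.\<close>
      have "cmod (V (of_real t - of_real a)) = 1" using on_real[of "t - a"] unit by simp
      then have w: "(norm w)\<^sup>2 = 2" unfolding norm_complex_2 w_def by simp
      define c where "c = (1 - l\<^sup>2) powr (- 1 / 2)"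
      have c: "c > 0" "ln c = - (1/2) * ln (1 - l\<^sup>2)" using l2 by (simp_all add: c_def ln_powr)
      have "An n t *v w = c ^ n *\<^sub>R vector [fst (orb n (of_real t)), snd (orb n (of_real t))]"
        unfolding An_def A_def w_def c_def orb_def by (rule cocycle_iter_szego_orbit[OF s l s_def])
      then have "(norm (An n t *v w))\<^sup>2 = (c ^ n)\<^sup>2 * N n (of_real t)"
        by (simp add: norm_complex_2 N_def power_mult_distrib distrib_left norm_power)
      moreover have "(norm (An n t *v w))\<^sup>2 \<le> (matrix_norm (An n t))\<^sup>2 * 2"
        using power_mono[OF onorm[OF bounded_linear_matrix_vector_complex] norm_ge_zero, of "An n t" w 2]
        by (simp add: power_mult_distrib w)
      moreover have m: "matrix_norm (An n t) \<ge> 1"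
        unfolding An_def by (rule matrix_norm_ge_1, rule det_cocycle_iter[OF contA detA])
      moreover have Np: "N n (of_real t) > 0" using \<rho>_pos by (intro Npos) simp
      ultimately have "ln ((c ^ n)\<^sup>2 * N n (of_real t)) \<le> ln ((matrix_norm (An n t))\<^sup>2 * 2)"
        using c by (intro ln_mono) auto
      then have "2 * real n * ln c + ln (N n (of_real t)) \<le> 2 * ln (matrix_norm (An n t)) + ln 2"
        using c Np m by (simp add: ln_mult_pos ln_realpow flip: power_mult)
      then show ?thesis unfolding c(2) by (simp add: complex_of_real_def)
    qed
    have intA: "(\<lambda>t. ln (matrix_norm (An n t))) integrable_on {0..1}"
      unfolding An_def
      by (intro integrable_continuous_real continuous_on_subset[OF continuous_ln_norm_cocycle_iter[OF contA detA]]) auto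
    have "\<Phi> n 0 \<le> integral {0..1} (\<lambda>t. 2 * ln (matrix_norm (An n t)) + (real n * ln (1 - l\<^sup>2) + ln 2))"
      unfolding \<Phi>_def using \<rho>_pos pw
      by (intro integral_le int integrable_add integrable_on_mult_right intA) auto
    also have "\<dots> = 2 * integral {0..1} (\<lambda>t. ln (matrix_norm (An n t))) + (real n * ln (1 - l\<^sup>2) + ln 2)"
      using intA by (subst integral_add) (auto intro: integrable_on_mult_right)
    finally show ?thesis by simp
  qed
  show ?thesis
    unfolding A_def[symmetric] r_def[symmetric] B_def[symmetric]
  proof (rule lyapunov_exponent_geI[OF contA detA, where c = "r * ln (1 + K) / (1 - r) + ln 2 / 2"])
    fix n :: nat
    have arith: "Q - (C + c / 2) \<le> I"
      if "2 * (p - C) \<le> P" "Q = p - x / 2" "P \<le> 2 * I + x + c" for Q C c I p P x :: real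
      using that by (simp add: field_simps)
    have "2 * real n * ln (d / 4) \<le> (1 - r) * \<Phi> n 0 + r * (2 * (real n + 1) * ln (1 + K))"
      using low[of n] three[of n] mult_left_mono[OF up[of n], of r] r by linarith
    then have "(2 * real n * ln (d / 4) - r * (2 * (real n + 1) * ln (1 + K))) / (1 - r) \<le> \<Phi> n 0"
      using r by (simp add: pos_divide_le_eq mult.commute)
    moreover have "(2 * real n * ln (d / 4) - r * (2 * (real n + 1) * ln (1 + K))) / (1 - r)
       = 2 * (real n * ((ln (d / 4) - r * ln (1 + K)) / (1 - r)) - r * ln (1 + K) / (1 - r))"
      unfolding times_divide_eq_right diff_divide_distrib[symmetric] by (simp add: algebra_simps)
    ultimately have "2 * (real n * B - r * ln (1 + K) / (1 - r)) \<le> \<Phi> n 0" by (simp only: B_def)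
    moreover have "real n * (- (1 / 2) * ln (1 - l\<^sup>2) + B) = real n * B - real n * ln (1 - l\<^sup>2) / 2"
      by (simp add: algebra_simps)
    ultimately show "integral {0..1} (\<lambda>t. ln (matrix_norm (cocycle_iter (circ_of a) A n (circ_of t))))
      \<ge> real n * (- (1 / 2) * ln (1 - l\<^sup>2) + B) - (r * ln (1 + K) / (1 - r) + ln 2 / 2)"
      using zero[of n] unfolding An_def by (rule arith)
  qed
qed

end

section \<open>Uniform lower bounds and vanishing exponents\<close>

context analytic_szego
begin

text \<open>By periodicity the zeros can be moved into one compact period, where there are only finitely many;
  hence only finitely many heights below \<open>y2\<close> are excluded.\<close>

lemma exists_line_without_zeros:
  assumes "v (circ_of (t - a)) \<noteq> - E * v (circ_of t)" and "0 < y2" "y2 < \<rho>"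
  obtains y where "0 < y" "y < y2" "\<And>z. Im z = y \<Longrightarrow> E + V (z - of_real a) / V z \<noteq> 0"
proof -
  define G where "G z = E + V (z - of_real a) / V z" for z
  define K where "K = cbox (Complex 0 (- y2)) (Complex 1 y2)"
  have K: "compact K" "K \<subseteq> strip \<rho>" using assms by (auto simp: K_def in_cbox_complex_iff)
  have holG: "G holomorphic_on strip \<rho>"
    unfolding G_def using holomorphic_shift[of "- a"] nz by (auto intro!: holomorphic_intros hol)
  have "V (of_real t) \<noteq> 0" using \<rho>_pos by (intro nz) simp
  then have Gt: "G (of_real t) \<noteq> 0"
    using assms(1) on_real[of t] on_real[of "t - a"] by (auto simp: G_def field_simps add_eq_0_iff2)
  have "finite {z \<in> K. G z = 0}"
  proof (cases "G constant_on strip \<rho>")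
    case True
    moreover have "of_real t \<in> strip \<rho>" using \<rho>_pos by simp
    ultimately have "G z \<noteq> 0" if "z \<in> strip \<rho>" for z
      using Gt that unfolding constant_on_def by metis
    then have "{z \<in> K. G z = 0} = {}" using K(2) by blast
    then show ?thesis by (simp only: finite.emptyI)
  next
    case False
    then show ?thesis
      by (intro holomorphic_compact_finite_zeros[OF holG open_strip convex_connected[OF convex_strip] K])
  qed
  then have "finite (Im ` {z \<in> K. G z = 0})" by simp
  moreover have "infinite {0<..<y2}" using assms by (simp add: infinite_Ioo)
  ultimately obtain y where y: "y \<in> {0<..<y2}" "y \<notin> Im ` {z \<in> K. G z = 0}"
    by (meson finite_subset subsetI)
  show thesis
  proof
    show "0 < y" "y < y2" using y by auto
    fix z assume z: "Im z = y"
    define n where "n = - floor (Re z)"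
    have "0 \<le> Re z + of_int n" "Re z + of_int n \<le> 1" unfolding n_def by (simp, linarith)+
    then have "z + of_int n \<in> K" using z y by (simp add: K_def in_cbox_complex_iff)
    moreover have "Im (z + of_int n) = y" using z by simp
    ultimately have "G (z + of_int n) \<noteq> 0" using y(2) by blast
    moreover have "V (z + of_int n) = V z" "V ((z - of_real a) + of_int n) = V (z - of_real a)"
      using z y assms by (auto intro!: periodic_int)
    ultimately show "E + V (z - of_real a) / V z \<noteq> 0" by (simp add: G_def algebra_simps)
  qed
qed

text \<open>The modulus has a positive minimum over one period of the line at \<open>(a0, E0)\<close>; uniform continuity
  on a compact neighbourhood keeps it above half of this value, and periodicity covers the whole line.\<close>

lemma uniform_gap_on_line:
  assumes "\<And>z. Im z = y \<Longrightarrow> E0 + V (z - of_real a0) / V z \<noteq> 0" and y: "\<bar>y\<bar> < \<rho>"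
  obtains e d where "e > 0" "d > 0"
    "\<And>a E z. \<bar>a - a0\<bar> < e \<Longrightarrow> cmod (E - E0) < e \<Longrightarrow> Im z = y \<Longrightarrow> d \<le> cmod (E + V (z - of_real a) / V z)"
proof -
  define G where "G = (\<lambda>(x, a, E). cmod (E + V (Complex x y - of_real a) / V (Complex x y)))"
  define S :: "(real \<times> real \<times> complex) set" where "S = {0..1} \<times> {a0 - 1..a0 + 1} \<times> cball E0 1"
  have cV: "continuous_on S (\<lambda>p. V (f p))" if "continuous_on S f" "\<And>p. Im (f p) = y" for f
    by (rule continuous_on_compose2[OF holomorphic_on_imp_continuous_on[OF hol] that(1)]) (use that y in auto)
  have contG: "continuous_on S G"
    unfolding G_def case_prod_unfold
  proof (intro continuous_intros cV)
    show "\<forall>p\<in>S. V (Complex (fst p) y) \<noteq> 0" using y by (auto intro!: nz)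
  qed (auto simp: Complex_eq intro!: continuous_intros)
  have compS: "compact S" unfolding S_def by (intro compact_Times compact_cball compact_Icc)
  define S0 where "S0 = {0..1::real} \<times> {(a0, E0)}"
  have S0: "compact S0" "S0 \<noteq> {}" "S0 \<subseteq> S"
    by (auto simp: S0_def S_def intro!: compact_Times)
  obtain p0 where p0: "p0 \<in> S0" "\<And>p. p \<in> S0 \<Longrightarrow> G p0 \<le> G p"
    using continuous_attains_inf[OF S0(1,2) continuous_on_subset[OF contG S0(3)]] by blast
  have "G p0 > 0" using p0(1) assms(1) by (auto simp: G_def S0_def)
  moreover have "uniformly_continuous_on S G" by (rule compact_uniformly_continuous[OF contG compS])
  ultimately obtain e where e: "e > 0"
    "\<And>p p'. p \<in> S \<Longrightarrow> p' \<in> S \<Longrightarrow> dist p' p < e \<Longrightarrow> dist (G p') (G p) < G p0 / 2"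
    unfolding uniformly_continuous_on_def by (metis half_gt_zero)
  define e' where "e' = min 1 (e / 2)"
  have low: "G p0 / 2 \<le> G (x, a, E)" if "\<bar>a - a0\<bar> < e'" "cmod (E - E0) < e'" "x \<in> {0..1}" for x a E
  proof -
    have "dist (x, a, E) (x, a0, E0) \<le> \<bar>a - a0\<bar> + cmod (E - E0)"
      using sqrt_sum_squares_le_sum_abs[of "a - a0" "cmod (E - E0)"]
      by (simp add: dist_norm norm_Pair)
    then have "dist (x, a, E) (x, a0, E0) < e" using that by (simp add: e'_def)
    moreover have "(x, a, E) \<in> S" "(x, a0, E0) \<in> S"
      using that by (auto simp: S_def e'_def dist_norm norm_minus_commute)
    ultimately have "dist (G (x, a, E)) (G (x, a0, E0)) < G p0 / 2" by (intro e(2))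
    moreover have "G p0 \<le> G (x, a0, E0)" using that by (intro p0(2)) (simp add: S0_def)
    ultimately show ?thesis unfolding dist_real_def by linarith
  qed
  show thesis
  proof
    show "e' > 0" "G p0 / 2 > 0" using e \<open>G p0 > 0\<close> by (simp_all add: e'_def)
    fix a E z assume *: "\<bar>a - a0\<bar> < e'" "cmod (E - E0) < e'" "Im z = y"
    define n where "n = - floor (Re z)"
    define x where "x = Re z + of_int n"
    have x: "x \<in> {0..1}" unfolding x_def n_def by simp linarith
    have z: "Complex x y = z + of_int n" using * by (simp add: complex_eq_iff x_def)
    have "V (z + of_int n) = V z" "V ((z - of_real a) + of_int n) = V (z - of_real a)"
      using * y by (auto intro!: periodic_int)
    then have "G (x, a, E) = cmod (E + V (z - of_real a) / V z)" by (simp add: G_def z algebra_simps)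
    then show "G p0 / 2 \<le> cmod (E + V (z - of_real a) / V z)" using low[OF *(1,2) x] by simp
  qed
qed

text \<open>For \<open>1 - l \<le> m\<close> the conditions of the cone argument hold, and the factor \<open>1 + l\<close> of \<open>1 - l\<^sup>2\<close> costs
  only \<open>ln 2 / 2\<close>. For smaller \<open>l\<close> the claim follows from nonnegativity of the exponent, if
  \<open>c \<le> ln m / 2\<close>.\<close>

lemma locally_uniform_lower_bound:
  assumes ne: "v (circ_of (t - a0)) \<noteq> - E0 * v (circ_of t)"
  obtains e c where "e > 0" "\<And>a E l. \<bar>a - a0\<bar> < e \<Longrightarrow> cmod (E - E0) < e \<Longrightarrow> cmod E = 1 \<Longrightarrow> 0 < l \<Longrightarrow> l < 1 \<Longrightarrow>
     lyapunov_exponent (circ_of a) (szego_cocycle E l v) \<ge> - (1 / 2) * ln (1 - l) + c"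
proof -
  define y2 where "y2 = \<rho> / 2"
  have y2: "0 < y2" "y2 < \<rho>" using \<rho>_pos by (simp_all add: y2_def)
  obtain y1 where y1: "0 < y1" "y1 < y2" "\<And>z. Im z = y1 \<Longrightarrow> E0 + V (z - of_real a0) / V z \<noteq> 0"
    using exists_line_without_zeros[OF ne y2] by blast
  have y1\<rho>: "\<bar>y1\<bar> < \<rho>" using y1 y2 by simp
  obtain e d where e: "e > 0" and d: "d > 0"
    and gap: "\<And>a E z. \<bar>a - a0\<bar> < e \<Longrightarrow> cmod (E - E0) < e \<Longrightarrow> Im z = y1 \<Longrightarrow> d \<le> cmod (E + V (z - of_real a) / V z)"
    by (rule uniform_gap_on_line[of y1 E0 a0]) (erule y1(3) | rule y1\<rho> | rule that; blast)+
  obtain K where K: "K \<ge> 1" "\<And>z. \<bar>Im z\<bar> \<le> y2 \<Longrightarrow> cmod (V z) \<le> K" "\<And>z. \<bar>Im z\<bar> \<le> y2 \<Longrightarrow> 1 / K \<le> cmod (V z)"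
    by (rule norm_bounds[OF y2(2)]) (rule that; blast)
  define m where "m = min (1/2) (min ((d / 4) / (1 + d / 2)) (d / (2 * K) * (d / 4) / (2 * K + d / (2 * K))))"
  have m: "0 < m" "m < 1" using d K(1) by (auto simp: m_def intro!: divide_pos_pos mult_pos_pos add_pos_pos)
  define B where "B = (ln (d / 4) - y1 / y2 * ln (1 + K)) / (1 - y1 / y2)"
  define c where "c = min (ln m / 2) (B - ln 2 / 2)"
  show thesis
  proof
    show "e > 0" by (rule e)
    fix a E and l :: real assume near: "\<bar>a - a0\<bar> < e" "cmod (E - E0) < e" and E: "cmod E = 1" and l: "0 < l" "l < 1"
    let ?L = "lyapunov_exponent (circ_of a) (szego_cocycle E l v)"
    show "?L \<ge> - (1 / 2) * ln (1 - l) + c"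
    proof (cases "1 - l \<le> m")
      case True
      have "1 - l \<le> (d / 4) / (1 + d / 2)" using True by (simp add: m_def)
      then have "(1 - l) * (1 + d / 2) \<le> d / 4"
        using d by (subst (asm) pos_le_divide_eq) auto
      moreover have "(1 - l) * (1 + d / 2) = (1 - l) + d / 2 - l * d / 2" by (simp add: field_simps)
      ultimately have l1: "d / 4 \<le> l * d / 2 - (1 - l)" by linarith
      have "1 - l \<le> d / (2 * K) * (d / 4) / (2 * K + d / (2 * K))" using True by (simp add: m_def)
      moreover have "2 * K + d / (2 * K) > 0" using d K(1) by (intro add_pos_pos divide_pos_pos) auto
      ultimately have l2: "(1 - l) * (2 * K + d / (2 * K)) \<le> d / (2 * K) * (d / 4)"
        by (simp only: pos_le_divide_eq)
      have "?L \<ge> - (1 / 2) * ln (1 - l\<^sup>2) + B"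
        unfolding B_def by (rule lyapunov_exponent_lower_bound[OF E l y1(1,2) y2(2) K d gap[OF near] l1 l2])
      moreover have "ln (1 - l\<^sup>2) \<le> ln (1 - l) + ln 2"
      proof -
        have "ln (1 - l\<^sup>2) = ln (1 - l) + ln (1 + l)"
          using l ln_mult_pos[of "1 - l" "1 + l"] by (simp add: power2_eq_square algebra_simps)
        also have "ln (1 + l) \<le> ln 2" using l by (intro ln_mono) auto
        finally show ?thesis by simp
      qed
      moreover have "c \<le> B - ln 2 / 2" unfolding c_def by (rule min.cobounded2)
      ultimately show ?thesis by linarith
    next
      case False
      then have "ln m \<le> ln (1 - l)" using m by (intro ln_mono) auto
      moreover have "c \<le> ln m / 2" unfolding c_def by (rule min.cobounded1)
      moreover have "?L \<ge> 0"
        by (rule lyapunov_exponent_nonneg[OF continuous_szego_cocycle[OF E] det_szego_cocycle[OF E l unit]])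
      ultimately show ?thesis by linarith
    qed
  qed
qed

text \<open>If the rotation multiplies \<open>v\<close> by \<open>\<mu>\<close> and \<open>E = - cnj \<mu>\<close>, the off-diagonal entries of
  \<open>A(x + a) A(x)\<close> cancel, and the normalising factor turns its diagonal entries into \<open>- cnj \<mu>\<close> and
  \<open>- \<mu>\<close>. Hence even iterates are isometries and all iterates are bounded.\<close>

lemma lyapunov_exponent_eq_0_if_rotated:
  assumes rot: "\<And>t. v (circ_of (t + a)) = \<mu> * v (circ_of t)" and \<mu>: "cmod \<mu> = 1"
    and l: "0 < l" "l < 1"
  shows "lyapunov_exponent (circ_of a) (szego_cocycle (- cnj \<mu>) l v) = 0"
proof -
  define E where "E = - cnj \<mu>"
  have E: "cmod E = 1" by (simp add: E_def \<mu>)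
  define A where "A = szego_cocycle E l v"
  have contA: "continuous_on UNIV (\<lambda>t. A (circ_of t))" and detA: "\<And>x. det (A x) = 1"
    unfolding A_def by (rule continuous_szego_cocycle[OF E], rule det_szego_cocycle[OF E l unit])
  define s where "s = csqrt E"
  have s: "s * s = E" "s \<noteq> 0" using E by (auto simp: s_def simp flip: power2_eq_square)
  have mm: "\<mu> * cnj \<mu> = 1" using complex_norm_square[of \<mu>] \<mu> by simp
  define c where "c = (1 - l\<^sup>2) powr (- 1 / 2)"
  have l2: "1 - l\<^sup>2 > 0" using l by (simp add: power_less_one_iff)
  have "c * c = (1 - l\<^sup>2) powr (- 1)" unfolding c_def by (simp flip: powr_add)
  then have c: "c * c * (1 - l\<^sup>2) = 1" using l2 by (simp add: powr_minus)
  have two: "A (circ_of (t + a)) ** A (circ_of t) = vector [vector [- cnj \<mu>, 0], vector [0, - \<mu>]]" for t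
  proof -
    define w where "w = v (circ_of t)"
    have ww: "w * cnj w = 1" using complex_norm_square[of w] unit[of "circ_of t"] by (simp add: w_def)
    have c': "of_real c * of_real c * (1 - of_real l * of_real l) = (1 :: complex)"
      using arg_cong[OF c, of complex_of_real] by (simp add: power2_eq_square)
    have w: "w \<noteq> 0" and cw: "cnj w = 1 / w" using ww by (auto simp: eq_divide_eq mult.commute)
    have c\<mu>: "cnj \<mu> = - (s * s)" using s by (simp add: E_def)
    have "1 / cnj \<mu> = \<mu>" using mm by (auto simp: divide_eq_eq)
    then have \<mu>s: "\<mu> = - (1 / (s * s))" unfolding s(1) E_def by simp
    have A1: "A (circ_of t) = c *\<^sub>R vector [vector [s, - of_real l * (1 / w) / s], vector [- of_real l * w * s, 1 / s]]"
      unfolding A_def szego_cocycle_def c_def s_def w_def[symmetric] cw ..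
    have A2: "A (circ_of (t + a)) = c *\<^sub>R vector [vector [s, of_real l * s / w], vector [of_real l * w / s, 1 / s]]"
      unfolding A_def szego_cocycle_def c_def[symmetric] s_def[symmetric] rot w_def[symmetric] complex_cnj_mult cw c\<mu>
      using s(2) by (simp add: \<mu>s)
    define k where "k = of_real c * of_real c * (1 - of_real l * of_real l :: complex)"
    have prod: "A (circ_of (t + a)) ** A (circ_of t) = vector [vector [k * (s * s), 0], vector [0, k * (1 / (s * s))]]"
      unfolding A1 A2 k_def using w s(2)
      by (simp add: vec_eq_iff forall_2 matrix_matrix_mult_def sum_2 scaleR_conv_of_real[where 'a=complex])
         (simp add: field_simps)
    show ?thesis
      unfolding prod c'[folded k_def] c\<mu> by (subst \<mu>s) simp
  qed
  have norm2: "matrix_norm (cocycle_iter (circ_of a) A 2 (circ_of t)) \<le> 1" for t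
  proof (rule onorm_le)
    fix w :: "complex^2"
    have "cocycle_iter (circ_of a) A 2 (circ_of t) = vector [vector [- cnj \<mu>, 0], vector [0, - \<mu>]]"
      using two[of t] by (simp add: numeral_2_eq_2 circ_of_add add.commute)
    then have "(norm (cocycle_iter (circ_of a) A 2 (circ_of t) *v w))\<^sup>2 = (norm w)\<^sup>2"
      by (simp add: norm_complex_2 matrix_vector_mult_def sum_2 norm_mult \<mu>)
    then show "norm (cocycle_iter (circ_of a) A 2 (circ_of t) *v w) \<le> 1 * norm w" by simp
  qed
  have "continuous_on {0..1} (\<lambda>t. matrix_norm (A (circ_of t)))"
    by (rule continuous_on_compose2[OF continuous_on_matrix_norm continuous_on_subset[OF contA]]) auto
  then have "bdd_above ((\<lambda>t. matrix_norm (A (circ_of t))) ` {0..1})"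
    by (intro bounded_imp_bdd_above compact_imp_bounded compact_continuous_image compact_Icc)
  then obtain M where M: "\<And>t. t \<in> {0..1} \<Longrightarrow> matrix_norm (A (circ_of t)) \<le> M"
    unfolding bdd_above_def by blast
  have M': "matrix_norm (A (circ_of t)) \<le> M" for t
  proof -
    have "circ_of t = circ_of (frac t)" using circ_of_plus_of_int[of "frac t" "floor t"] by (simp add: frac_def)
    then show ?thesis using M[of "frac t"] by (simp add: frac_lt_1 less_imp_le)
  qed
  have "matrix_norm (cocycle_iter (circ_of a) A n (circ_of t)) \<le> max 1 M" for n t
  proof (induction n rule: induct_nat_012)
    case 0
    show ?case using onorm_id_le[where 'a = "complex^2"] by (simp add: le_max_iff_disj)
  next
    case 1
    show ?case using M' by (simp add: le_max_iff_disj)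
  next
    case (ge2 n)
    have "cocycle_iter (circ_of a) A (Suc (Suc n)) (circ_of t)
      = cocycle_iter (circ_of a) A 2 (circ_of (t + real n * a)) ** cocycle_iter (circ_of a) A n (circ_of t)"
      using cocycle_iter_add[of "circ_of a" A 2 n "circ_of t"] by (simp add: circ_rotation_iter_circ_of)
    then have "matrix_norm (cocycle_iter (circ_of a) A (Suc (Suc n)) (circ_of t))
      \<le> matrix_norm (cocycle_iter (circ_of a) A 2 (circ_of (t + real n * a))) * matrix_norm (cocycle_iter (circ_of a) A n (circ_of t))"
      by (simp only: matrix_norm_mult)
    also have "\<dots> \<le> 1 * max 1 M"
      by (intro mult_mono norm2 ge2 onorm_pos_le bounded_linear_matrix_vector_complex) simp
    finally show ?case by simp
  qed
  then have "lyapunov_exponent (circ_of a) A = 0" by (rule lyapunov_exponent_eq_0I[OF contA detA])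
  then show ?thesis by (simp add: A_def E_def)
qed

end

text \<open>The preimage of the image of \<open>B\<close> is the union of the integer translates of \<open>B\<close>.\<close>

lemma open_image_circ_of:
  assumes "open B"
  shows "open (circ_of ` B)"
proof -
  have "circ_of -` (circ_of ` B) = (\<Union>n. (+) (of_int n) ` B)"
  proof (intro equalityI subsetI)
    fix x assume "x \<in> circ_of -` (circ_of ` B)"
    then obtain b where b: "b \<in> B" "x - b \<in> \<int>" by (auto simp: circ_of_eq_iff)
    then obtain n where "x - b = of_int n" by (elim Ints_cases)
    then have "x = of_int n + b" by simp
    then show "x \<in> (\<Union>n. (+) (of_int n) ` B)" using b by blast
  next
    fix x assume "x \<in> (\<Union>n. (+) (of_int n) ` B)"
    then obtain n b where "b \<in> B" "x = b + of_int n" by (auto simp: add.commute)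
    then show "x \<in> circ_of -` (circ_of ` B)" by auto
  qed
  then show ?thesis unfolding open_circ_def using assms by (auto intro: open_translation)
qed

text \<open>The projection from the real line to the circle is open, so the local bounds hold on open subsets of
  the parameter space, finitely many of which cover \<open>C\<close>.\<close>

lemma (in analytic_szego) uniform_lower_bound_on_compact:
  assumes "compact C" and "C \<subseteq> UNIV \<times> sphere 0 1"
    and ne: "\<And>a E. (circ_of a, E) \<in> C \<Longrightarrow> \<exists>t. v (circ_of (t - a)) \<noteq> - E * v (circ_of t)"
  shows "\<exists>c. \<forall>(\<alpha>, E)\<in>C. \<forall>l\<in>{0<..<1}.
     lyapunov_exponent \<alpha> (szego_cocycle E l v) \<ge> - (1 / 2) * ln (1 - l) + c"
proof -
  define good where "good p a e c \<longleftrightarrow> circ_of a = fst p \<and> e > 0 \<and>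
     (\<forall>b E l. \<bar>b - a\<bar> < e \<longrightarrow> cmod (E - snd p) < e \<longrightarrow> cmod E = 1 \<longrightarrow> 0 < l \<longrightarrow> l < 1 \<longrightarrow>
     lyapunov_exponent (circ_of b) (szego_cocycle E l v) \<ge> - (1 / 2) * ln (1 - l) + c)" for p a e c
  have "\<exists>a e c. good p a e c" if p: "p \<in> C" for p
  proof -
    obtain a where a: "circ_of a = fst p" using surjD[OF surj_circ_of] by metis
    then obtain t where "v (circ_of (t - a)) \<noteq> - snd p * v (circ_of t)" using ne[of a "snd p"] p by auto
    then obtain e c where "e > 0" "\<And>b E l. \<bar>b - a\<bar> < e \<Longrightarrow> cmod (E - snd p) < e \<Longrightarrow> cmod E = 1 \<Longrightarrow> 0 < l \<Longrightarrow> l < 1 \<Longrightarrow>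
     lyapunov_exponent (circ_of b) (szego_cocycle E l v) \<ge> - (1 / 2) * ln (1 - l) + c"
      by (rule locally_uniform_lower_bound) (rule that; blast)
    then have "good p a e c" using a by (simp add: good_def)
    then show ?thesis by blast
  qed
  then obtain a e c where g: "\<And>p. p \<in> C \<Longrightarrow> good p (a p) (e p) (c p)" by metis
  define U where "U p = (circ_of ` ball (a p) (e p)) \<times> ball (snd p) (e p)" for p
  have op: "open (U p)" for p unfolding U_def by (intro open_Times open_image_circ_of open_ball)
  have mem: "p \<in> U p" if "p \<in> C" for p
  proof -
    have "fst p \<in> circ_of ` ball (a p) (e p)"
      using g[OF that] by (intro image_eqI[of _ _ "a p"]) (auto simp: good_def)
    then show ?thesis using g[OF that] by (cases p) (auto simp: U_def good_def)
  qed
  have "C \<subseteq> (\<Union>p\<in>C. U p)" using mem by blast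
  from compactE_image[OF \<open>compact C\<close> op this] obtain D
    where D: "D \<subseteq> C" "finite D" "C \<subseteq> (\<Union>p\<in>D. U p)" .
  define c0 where "c0 = Min (insert 0 (c ` D))"
  have "lyapunov_exponent \<alpha> (szego_cocycle E l v) \<ge> - (1 / 2) * ln (1 - l) + c0"
    if *: "(\<alpha>, E) \<in> C" "l \<in> {0<..<1}" for \<alpha> E l
  proof -
    obtain p where p: "p \<in> D" "(\<alpha>, E) \<in> U p" using D * by blast
    obtain b where b: "\<alpha> = circ_of b" "b \<in> ball (a p) (e p)" "E \<in> ball (snd p) (e p)"
      using p(2) by (auto simp: U_def)
    have "cmod E = 1" using * assms(2) by auto
    then have "lyapunov_exponent \<alpha> (szego_cocycle E l v) \<ge> - (1 / 2) * ln (1 - l) + c p"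
      using g[of p] p D b * by (auto simp: good_def dist_norm norm_minus_commute abs_minus_commute)
    moreover have "c0 \<le> c p" unfolding c0_def using D p by (intro Min_le) auto
    ultimately show ?thesis by linarith
  qed
  then show ?thesis by blast
qed

lemma continuous_integer_valued_differences_const:
  fixes g :: "real \<Rightarrow> real"
  assumes "continuous_on UNIV g" "\<And>x y. g x - g y \<in> \<int>"
  shows "g x = g y"
proof -
  have "g constant_on UNIV"
  proof (rule continuous_discrete_range_constant[OF connected_UNIV assms(1)])
    fix x :: real
    have "1 \<le> \<bar>g y - g x\<bar>" if "g y \<noteq> g x" for y
      using assms(2)[of y x] that by (metis Ints_nonzero_abs_ge1 right_minus_eq)
    then show "\<exists>e>0. \<forall>y. y \<in> UNIV \<and> g y \<noteq> g x \<longrightarrow> e \<le> norm (g y - g x)"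
      by (intro exI[of _ 1]) auto
  qed
  then show ?thesis by (auto simp: constant_on_def)
qed

text \<open>The hypothesis fixes \<open>exp (2 \<pi> i g)\<close> for the continuous function \<open>g(t) = \<theta>(t - a) - \<theta>(t)\<close>. So \<open>g\<close> is
  constant, and this constant is its mean, which is zero because the rotation preserves the mean of
  \<open>\<theta>\<close>.\<close>

lemma sampling_rotation_imp_period:
  assumes cont: "continuous_on UNIV (\<lambda>t. \<theta> (circ_of t))"
    and rot: "\<And>t. sampling \<theta> k (circ_of (t - a)) = - E * sampling \<theta> k (circ_of t)"
  shows "\<theta> (x + circ_of a) = \<theta> x" and "E = - exp (- (2 * pi * \<i> * of_real (of_int k * a)))"
proof -
  define h where "h t = \<theta> (circ_of t)" for t
  define g where "g t = h (t - a) - h t" for t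
  have ch: "continuous_on UNIV h" using cont by (simp add: h_def)
  have hper: "h (t + 1) = h t" for t by (simp add: h_def)
  have ga: "exp (2 * pi * \<i> * of_real (g t - of_int k * a)) = - E" for t
  proof -
    have "exp (2 * pi * \<i> * of_real (of_int k * (t - a) + h (t - a))) = - E * exp (2 * pi * \<i> * of_real (of_int k * t + h t))"
      using rot[of t] unfolding sampling_circ_of h_def .
    moreover have "2 * pi * \<i> * of_real (of_int k * (t - a) + h (t - a))
      = 2 * pi * \<i> * of_real (g t - of_int k * a) + 2 * pi * \<i> * of_real (of_int k * t + h t)"
      by (simp add: g_def algebra_simps)
    ultimately have "exp (2 * pi * \<i> * of_real (g t - of_int k * a)) * exp (2 * pi * \<i> * of_real (of_int k * t + h t))
      = - E * exp (2 * pi * \<i> * of_real (of_int k * t + h t))"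
      by (simp only: exp_add)
    then show ?thesis by (rule mult_right_cancel[OF exp_not_eq_zero, THEN iffD1])
  qed
  have cg: "continuous_on UNIV g"
    unfolding g_def by (intro continuous_intros ch continuous_on_compose2[OF ch]) auto
  have "g x - g y \<in> \<int>" for x y
  proof -
    have "exp (2 * pi * \<i> * of_real (g x - of_int k * a)) = exp (2 * pi * \<i> * of_real (g y - of_int k * a))"
      by (simp only: ga)
    then obtain n :: int where "2 * pi * \<i> * of_real (g x - of_int k * a) = 2 * pi * \<i> * of_real (g y - of_int k * a) + (of_int (2 * n) * pi) * \<i>"
      unfolding exp_eq by blast
    then have "Im (2 * pi * \<i> * of_real (g x - of_int k * a)) = Im (2 * pi * \<i> * of_real (g y - of_int k * a) + (of_int (2 * n) * pi) * \<i>)"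
      by (rule arg_cong)
    then have "2 * pi * (g x - of_int k * a) = 2 * pi * (g y - of_int k * a) + 2 * of_int n * pi" by simp
    then have "2 * pi * (g x - g y) = 2 * pi * of_int n" by (simp add: algebra_simps)
    then have "g x - g y = of_int n" by simp
    then show ?thesis by simp
  qed
  from continuous_integer_valued_differences_const[OF cg this] have gc: "g t = g 0" for t .
  have "integral {0..1} (\<lambda>t. h (t - a)) = integral {0..1} h"
    using integral_shift_periodic[OF ch hper, of "- a"] by simp
  moreover have "integral {0..1} g = integral {0..1} (\<lambda>t. h (t - a)) - integral {0..1} h"
    unfolding g_def
    by (intro integral_diff integrable_continuous_real continuous_on_compose2[OF ch] continuous_intros) auto
  moreover have "integral {0..1} g = g 0"
    using integral_cong[of "{0..1}" g "\<lambda>_. g 0"] gc by simp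
  ultimately have g0: "g t = 0" for t using gc by simp
  have "h (t + a) = h t" for t using g0[of "t + a"] by (simp add: g_def)
  then have "\<forall>x. \<theta> (x + circ_of a) = \<theta> x" unfolding circ_period_iff h_def by blast
  then show "\<theta> (x + circ_of a) = \<theta> x" by blast
  show "E = - exp (- (2 * pi * \<i> * of_real (of_int k * a)))" using ga[of 0] g0[of 0] by simp
qed

section \<open>The exceptional set\<close>

text \<open>One energy for each period \<open>p / q\<close> of \<open>\<theta>\<close>: the one for which \<open>v(x - p / q) = - E v(x)\<close>.\<close>

definition exceptional_set :: "(circ \<Rightarrow> real) \<Rightarrow> int \<Rightarrow> (circ \<times> complex) set" where
  "exceptional_set \<theta> k = (\<lambda>p. let a = real p / real (max_period_denom \<theta>) in
     (circ_of a, - exp (- (2 * pi * \<i> * of_real (of_int k * a))))) ` {..<max_period_denom \<theta>}"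

lemma sampling_rotation_imp_exceptional:
  assumes cont: "continuous_on UNIV (\<lambda>t. \<theta> (circ_of t))" and nonconst: "\<not> \<theta> constant_on UNIV"
    and rot: "\<And>t. sampling \<theta> k (circ_of (t - a)) = - E * sampling \<theta> k (circ_of t)"
  shows "(circ_of a, E) \<in> exceptional_set \<theta> k"
proof -
  obtain p where p: "p < max_period_denom \<theta>" "circ_of a = circ_of (real p / real (max_period_denom \<theta>))"
    using period_eq_fraction[OF cont nonconst sampling_rotation_imp_period(1)[OF cont rot]] .
  define b where "b = real p / real (max_period_denom \<theta>)"
  have "a - b \<in> \<int>" using p(2) by (simp add: b_def circ_of_eq_iff)
  then obtain n where n: "a - b = of_int n" by (elim Ints_cases)
  then have a: "a = b + of_int n" by simp
  have "- (2 * pi * \<i> * of_real (of_int k * a)) = - (2 * pi * \<i> * of_real (of_int k * b)) + (of_int (2 * (- k * n)) * pi) * \<i>"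
    by (simp add: a algebra_simps)
  then have "exp (- (2 * pi * \<i> * of_real (of_int k * a))) = exp (- (2 * pi * \<i> * of_real (of_int k * b)))"
    unfolding exp_eq by blast
  then have "E = - exp (- (2 * pi * \<i> * of_real (of_int k * b)))"
    using sampling_rotation_imp_period(2)[OF cont rot] by simp
  then show ?thesis
    using p unfolding exceptional_set_def by (intro image_eqI[of _ _ p]) (auto simp: b_def Let_def)
qed

lemma analytic_szego_sampling:
  assumes "real_analytic_circ \<theta>"
  obtains V \<rho> where "analytic_szego (sampling \<theta> k) V \<rho>"
proof -
  obtain \<rho> \<Theta> where \<Theta>: "\<rho> > 0" "\<Theta> holomorphic_on strip \<rho>"
    "\<And>t. \<Theta> (of_real t) = of_real (\<theta> (circ_of t))"
    "\<And>z. z \<in> strip \<rho> \<Longrightarrow> \<Theta> (z + 1) = \<Theta> z"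
    using real_analytic_circ_holomorphic_extension[OF assms] by blast
  define V where "V z = exp (2 * pi * \<i> * (of_int k * z + \<Theta> z))" for z
  have "analytic_szego (sampling \<theta> k) V \<rho>"
  proof
    show "V holomorphic_on strip \<rho>" unfolding V_def by (intro holomorphic_intros \<Theta>)
    show "V z \<noteq> 0" for z by (simp add: V_def)
    show "V (z + 1) = V z" if "z \<in> strip \<rho>" for z
    proof -
      have "2 * pi * \<i> * (of_int k * (z + 1) + \<Theta> (z + 1)) = 2 * pi * \<i> * (of_int k * z + \<Theta> z) + (of_int (2 * k) * pi) * \<i>"
        unfolding \<Theta>(4)[OF that] by (simp add: algebra_simps)
      then show ?thesis unfolding V_def exp_eq by blast
    qed
    show "V (of_real t) = sampling \<theta> k (circ_of t)" for t
      unfolding V_def sampling_circ_of \<Theta>(3) by simp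
    show "cmod (sampling \<theta> k x) = 1" for x
    proof -
      obtain t where "x = circ_of t" using surjD[OF surj_circ_of] by blast
      then show ?thesis by (simp add: sampling_circ_of)
    qed
  qed (rule \<Theta>)
  then show thesis by (rule that)
qed

theorem theoremA:
  fixes \<theta> :: "circ \<Rightarrow> real" and k :: int
  assumes "real_analytic_circ \<theta>" and "\<not> \<theta> constant_on UNIV"
  shows "\<exists>F :: (circ \<times> complex) set.
    finite F \<and> F \<subseteq> UNIV \<times> sphere 0 1 \<and>
    fst ` F \<subseteq> {circ_of (real p / real (max_period_denom \<theta>)) | p. p < max_period_denom \<theta>} \<and>
    (\<forall>C. compact C \<and> C \<subseteq> (UNIV \<times> sphere 0 1) - F \<longrightarrow>
      (\<exists>c0 :: real. \<forall>(\<alpha>, E) \<in> C. \<forall>l \<in> {0<..<1}.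
        lyapunov_exponent \<alpha> (szego_cocycle E l (sampling \<theta> k)) \<ge> - (1 / 2) * ln (1 - l) + c0)) \<and>
    (\<forall>(\<alpha>, E) \<in> F. \<forall>l \<in> {0<..<1}.
      lyapunov_exponent \<alpha> (szego_cocycle E l (sampling \<theta> k)) = 0)"
proof (intro exI[of _ "exceptional_set \<theta> k"] conjI allI impI)
  obtain V \<rho> where "analytic_szego (sampling \<theta> k) V \<rho>"
    using analytic_szego_sampling[OF assms(1)] .
  then interpret analytic_szego "sampling \<theta> k" V \<rho> .
  have cont: "continuous_on UNIV (\<lambda>t. \<theta> (circ_of t))"
  proof -
    obtain \<rho>' \<Theta> where \<Theta>: "\<rho>' > 0" "\<Theta> holomorphic_on strip \<rho>'"
      "\<And>t. \<Theta> (of_real t) = of_real (\<theta> (circ_of t))"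
      using real_analytic_circ_holomorphic_extension[OF assms(1)] by blast
    have "continuous_on UNIV (\<lambda>t. Re (\<Theta> (of_real t)))"
      by (intro continuous_intros continuous_on_compose2[OF holomorphic_on_imp_continuous_on[OF \<Theta>(2)]])
         (use \<Theta>(1) in auto)
    then show ?thesis by (simp add: \<Theta>(3))
  qed
  show "finite (exceptional_set \<theta> k)" by (simp add: exceptional_set_def)
  show "exceptional_set \<theta> k \<subseteq> UNIV \<times> sphere 0 1"
    by (auto simp: exceptional_set_def Let_def)
  show "fst ` exceptional_set \<theta> k \<subseteq> {circ_of (real p / real (max_period_denom \<theta>)) | p. p < max_period_denom \<theta>}"
    by (auto simp: exceptional_set_def Let_def)
  show "\<exists>c0. \<forall>(\<alpha>, E)\<in>C. \<forall>l\<in>{0<..<1}.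
      lyapunov_exponent \<alpha> (szego_cocycle E l (sampling \<theta> k)) \<ge> - (1 / 2) * ln (1 - l) + c0"
    if C: "compact C \<and> C \<subseteq> (UNIV \<times> sphere 0 1) - exceptional_set \<theta> k" for C
  proof -
    have "\<exists>t. sampling \<theta> k (circ_of (t - a)) \<noteq> - E * sampling \<theta> k (circ_of t)" if "(circ_of a, E) \<in> C" for a E
      using sampling_rotation_imp_exceptional[OF cont assms(2), of k a E] C that by blast
    then show ?thesis
      using C by (intro uniform_lower_bound_on_compact) auto
  qed
  show "\<forall>(\<alpha>, E)\<in>exceptional_set \<theta> k. \<forall>l\<in>{0<..<1}. lyapunov_exponent \<alpha> (szego_cocycle E l (sampling \<theta> k)) = 0"
  proof safe
    fix \<alpha> E and l :: real assume F: "(\<alpha>, E) \<in> exceptional_set \<theta> k" and l: "l \<in> {0<..<1}"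
    obtain p where p: "\<alpha> = circ_of (real p / real (max_period_denom \<theta>))"
      "E = - exp (- (2 * pi * \<i> * of_real (of_int k * (real p / real (max_period_denom \<theta>)))))"
      using F unfolding exceptional_set_def Let_def by blast
    define a where "a = real p / real (max_period_denom \<theta>)"
    define \<mu> where "\<mu> = exp (2 * pi * \<i> * of_real (of_int k * a))"
    have "cmod \<mu> = 1" by (simp add: \<mu>_def)
    have E: "E = - cnj \<mu>" unfolding p(2) \<mu>_def a_def exp_cnj by simp
    have "sampling \<theta> k (circ_of (t + a)) = \<mu> * sampling \<theta> k (circ_of t)" for t
    proof -
      have "\<theta> (circ_of (t + a)) = \<theta> (circ_of t)"
        unfolding circ_of_add a_def by (rule fraction_is_period[OF cont assms(2)])
      then show ?thesis
        unfolding sampling_circ_of \<mu>_def exp_add[symmetric] by (simp add: algebra_simps)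
    qed
    then show "lyapunov_exponent \<alpha> (szego_cocycle E l (sampling \<theta> k)) = 0"
      unfolding p(1) a_def[symmetric] E using \<open>cmod \<mu> = 1\<close> l
      by (intro lyapunov_exponent_eq_0_if_rotated) auto
  qed
qed

end
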